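(* Let $K\subseteq F_1$ and $K\subseteq F_2$ be field extensions. Let $A$ and $B$ be two $K$-algebras of the same (possibly infinite) dimension $\omega$. Suppose that the cardinal of $K$ is strictly greater than $\omega$ and that $\bar{K}\subseteq F_2$, where $\bar{K}$ is an algebraic closure of $K$ (the inclusion being compatible with $K\subseteq F_2$). If $A_{F_1}\cong B_{F_1}$ as $F_1$-algebras, then $A_{F_2}\cong B_{F_2}$ as $F_2$-algebras.
   Context: Algebras are not necessarily associative, commutative or unital. Dimension means the cardinality of a $K$-vector space basis. For a $K$-algebra $A$ and a field extension $K\subseteq F$, $A_F:=A\otimes_K F$, regarded as an $F$-algebra. *)

theory Defs
  imports "HOL-Library.Poly_Mapping" "HOL-Library.Equipollence"
    "HOL-Computational_Algebra.Polynomial"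
begin

section \<open>Field extensions and algebraic closures\<close>

text \<open>
  A field extension \<open>K \<subseteq> F\<close> is rendered by its inclusion map, i.e. by a unital ring homomorphism
  between fields (automatically injective).
\<close>

locale field_extension =
  fixes incl :: "'k::field \<Rightarrow> 'f::field"
  assumes incl_one: "incl 1 = 1"
    and incl_add: "incl (x + y) = incl x + incl y"
    and incl_mult: "incl (x * y) = incl x * incl y"

locale algebraic_closure_of = field_extension incl
  for incl :: "'k::field \<Rightarrow> 'c::alg_closed_field" +
  assumes algebraic: "\<exists>p. p \<noteq> 0 \<and> poly (map_poly incl p) z = 0"


section \<open>Algebras and their dimension\<close>

locale nonassoc_algebra = vector_space scale
  for scale :: "'k::field \<Rightarrow> 'a::ab_group_add \<Rightarrow> 'a" +
  fixes mult :: "'a \<Rightarrow> 'a \<Rightarrow> 'a"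
  assumes mult_add_left: "mult (a + b) c = mult a c + mult b c"
    and mult_add_right: "mult a (b + c) = mult a b + mult a c"
    and mult_scale_left: "mult (scale k a) b = scale k (mult a b)"
    and mult_scale_right: "mult a (scale k b) = scale k (mult a b)"

text \<open>
  Cardinals are represented by arbitrary sets, so that infinite dimensions are not identified:
  \<open>has_dimension scale W\<close> means that the dimension is the cardinality of \<open>W\<close>.
\<close>

definition has_dimension :: "('k::field \<Rightarrow> 'a::ab_group_add \<Rightarrow> 'a) \<Rightarrow> 'w set \<Rightarrow> bool"
  where "has_dimension scale W \<longleftrightarrow>
    (\<exists>B. \<not> module.dependent scale B \<and> module.span scale B = UNIV \<and> B \<approx> W)"


section \<open>Algebras on a carrier set\<close>

text \<open>
  The tensor product is a quotient whose equivalence relation depends on the given structures, so it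
  lives on a carrier set rather than on a whole type.
\<close>

record ('f, 'v) alg =
  alg_carrier :: "'v set"
  alg_add :: "'v \<Rightarrow> 'v \<Rightarrow> 'v"
  alg_smult :: "'f \<Rightarrow> 'v \<Rightarrow> 'v"
  alg_mult :: "'v \<Rightarrow> 'v \<Rightarrow> 'v"

definition alg_isomorphic :: "('f, 'v) alg \<Rightarrow> ('f, 'w) alg \<Rightarrow> bool"
  where "alg_isomorphic M N \<longleftrightarrow>
    (\<exists>\<phi>. bij_betw \<phi> (alg_carrier M) (alg_carrier N) \<and>
      (\<forall>X\<in>alg_carrier M. \<forall>Y\<in>alg_carrier M. \<phi> (alg_add M X Y) = alg_add N (\<phi> X) (\<phi> Y)) \<and>
      (\<forall>c. \<forall>X\<in>alg_carrier M. \<phi> (alg_smult M c X) = alg_smult N c (\<phi> X)) \<and>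
      (\<forall>X\<in>alg_carrier M. \<forall>Y\<in>alg_carrier M. \<phi> (alg_mult M X Y) = alg_mult N (\<phi> X) (\<phi> Y)))"

locale carrier_algebra =
  fixes M :: "('f::field, 'v) alg"
  assumes add_closed: "\<lbrakk>X \<in> alg_carrier M; Y \<in> alg_carrier M\<rbrakk> \<Longrightarrow> alg_add M X Y \<in> alg_carrier M"
    and smult_closed: "X \<in> alg_carrier M \<Longrightarrow> alg_smult M c X \<in> alg_carrier M"
    and mult_closed: "\<lbrakk>X \<in> alg_carrier M; Y \<in> alg_carrier M\<rbrakk> \<Longrightarrow> alg_mult M X Y \<in> alg_carrier M"
    and add_assoc: "\<lbrakk>X \<in> alg_carrier M; Y \<in> alg_carrier M; Z \<in> alg_carrier M\<rbrakk> \<Longrightarrow>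
      alg_add M (alg_add M X Y) Z = alg_add M X (alg_add M Y Z)"
    and add_comm: "\<lbrakk>X \<in> alg_carrier M; Y \<in> alg_carrier M\<rbrakk> \<Longrightarrow> alg_add M X Y = alg_add M Y X"
    and add_zero_minus: "\<exists>Z\<in>alg_carrier M. \<forall>X\<in>alg_carrier M.
      alg_add M Z X = X \<and> (\<exists>Y\<in>alg_carrier M. alg_add M X Y = Z)"
    and smult_add_right: "\<lbrakk>X \<in> alg_carrier M; Y \<in> alg_carrier M\<rbrakk> \<Longrightarrow>
      alg_smult M c (alg_add M X Y) = alg_add M (alg_smult M c X) (alg_smult M c Y)"
    and smult_add_left: "X \<in> alg_carrier M \<Longrightarrow>
      alg_smult M (c + d) X = alg_add M (alg_smult M c X) (alg_smult M d X)"
    and smult_assoc: "X \<in> alg_carrier M \<Longrightarrow> alg_smult M c (alg_smult M d X) = alg_smult M (c * d) X"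
    and smult_one: "X \<in> alg_carrier M \<Longrightarrow> alg_smult M 1 X = X"
    and mult_add_left: "\<lbrakk>X \<in> alg_carrier M; Y \<in> alg_carrier M; Z \<in> alg_carrier M\<rbrakk> \<Longrightarrow>
      alg_mult M (alg_add M X Y) Z = alg_add M (alg_mult M X Z) (alg_mult M Y Z)"
    and mult_add_right: "\<lbrakk>X \<in> alg_carrier M; Y \<in> alg_carrier M; Z \<in> alg_carrier M\<rbrakk> \<Longrightarrow>
      alg_mult M X (alg_add M Y Z) = alg_add M (alg_mult M X Y) (alg_mult M X Z)"
    and mult_smult_left: "\<lbrakk>X \<in> alg_carrier M; Y \<in> alg_carrier M\<rbrakk> \<Longrightarrow>
      alg_mult M (alg_smult M c X) Y = alg_smult M c (alg_mult M X Y)"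
    and mult_smult_right: "\<lbrakk>X \<in> alg_carrier M; Y \<in> alg_carrier M\<rbrakk> \<Longrightarrow>
      alg_mult M X (alg_smult M c Y) = alg_smult M c (alg_mult M X Y)"


section \<open>Extension of scalars\<close>

text \<open>
  \<open>A \<otimes>\<^sub>K F\<close> is the free abelian group on \<open>A \<times> F\<close> modulo the subgroup generated by the
  usual (biadditive and \<open>K\<close>-balanced) relations. The generator \<open>frag_of (a, x)\<close> represents
  the pure tensor \<open>a \<otimes> x\<close>.
\<close>

definition tensor_rels ::
    "('k \<Rightarrow> 'f::field) \<Rightarrow> ('k::field \<Rightarrow> 'a::ab_group_add \<Rightarrow> 'a) \<Rightarrow> ('a \<times> 'f \<Rightarrow>\<^sub>0 int) set"
  where "tensor_rels incl scale =
      {frag_of (a + b, x) - frag_of (a, x) - frag_of (b, x) | a b x. True}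
    \<union> {frag_of (a, x + y) - frag_of (a, x) - frag_of (a, y) | a x y. True}
    \<union> {frag_of (scale k a, x) - frag_of (a, incl k * x) | k a x. True}"

definition tensor_cong ::
    "('k \<Rightarrow> 'f::field) \<Rightarrow> ('k::field \<Rightarrow> 'a::ab_group_add \<Rightarrow> 'a) \<Rightarrow>
      (('a \<times> 'f \<Rightarrow>\<^sub>0 int) \<times> ('a \<times> 'f \<Rightarrow>\<^sub>0 int)) set"
  where "tensor_cong incl scale =
    {(u, v). u - v \<in> module.span frag_cmul (tensor_rels incl scale)}"

text \<open>
  On representatives, the \<open>F\<close>-action and the product are the biadditive extensions of
  \<open>c (a \<otimes> x) = a \<otimes> c x\<close> and \<open>(a \<otimes> x) (b \<otimes> y) = a b \<otimes> x y\<close>.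
\<close>

definition free_smult :: "'f::field \<Rightarrow> ('a \<times> 'f \<Rightarrow>\<^sub>0 int) \<Rightarrow> ('a \<times> 'f \<Rightarrow>\<^sub>0 int)"
  where "free_smult c = frag_extend (\<lambda>(a, x). frag_of (a, c * x))"

definition free_mult :: "('a \<Rightarrow> 'a \<Rightarrow> 'a) \<Rightarrow>
    ('a \<times> 'f::field \<Rightarrow>\<^sub>0 int) \<Rightarrow> ('a \<times> 'f \<Rightarrow>\<^sub>0 int) \<Rightarrow> ('a \<times> 'f \<Rightarrow>\<^sub>0 int)"
  where "free_mult m u v =
    frag_extend (\<lambda>(a, x). frag_extend (\<lambda>(b, y). frag_of (m a b, x * y)) v) u"

definition base_change ::
    "('k \<Rightarrow> 'f::field) \<Rightarrow> ('k::field \<Rightarrow> 'a::ab_group_add \<Rightarrow> 'a) \<Rightarrow> ('a \<Rightarrow> 'a \<Rightarrow> 'a) \<Rightarrow>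
      ('f, ('a \<times> 'f \<Rightarrow>\<^sub>0 int) set) alg"
  where "base_change incl scale m =
    \<lparr> alg_carrier = UNIV // tensor_cong incl scale,
      alg_add = (\<lambda>X Y. \<Union>u\<in>X. \<Union>v\<in>Y. tensor_cong incl scale `` {u + v}),
      alg_smult = (\<lambda>c X. \<Union>u\<in>X. tensor_cong incl scale `` {free_smult c u}),
      alg_mult = (\<lambda>X Y. \<Union>u\<in>X. \<Union>v\<in>Y. tensor_cong incl scale `` {free_mult m u v}) \<rparr>"

text \<open>The operations are well defined and make the quotient an \<open>F\<close>-algebra.\<close>

lemma module_frag: "module (frag_cmul :: int \<Rightarrow> ('b \<Rightarrow>\<^sub>0 int) \<Rightarrow> _)"
  by unfold_locales (simp_all add: frag_cmul_distrib frag_cmul_distrib2)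

interpretation frag: module "frag_cmul :: int \<Rightarrow> ('b \<Rightarrow>\<^sub>0 int) \<Rightarrow> _"
  by (rule module_frag)

(* opposite orientation to the library simp rule minus_frag_cmul; together they loop *)
declare frag.scale_minus_left [simp del]

lemma equiv_tensor_cong: "equiv UNIV (tensor_cong i s)"
proof (rule equivI)
  show "tensor_cong i s \<subseteq> UNIV \<times> UNIV" by simp
  show "refl (tensor_cong i s)"
    by (auto simp: refl_on_def tensor_cong_def frag.span_zero)
  show "sym (tensor_cong i s)"
    unfolding sym_def tensor_cong_def by (auto dest: frag.span_neg)
  show "trans (tensor_cong i s)"
    unfolding trans_def tensor_cong_def
  proof (clarsimp)
    fix x y z
    assume "x - y \<in> frag.span (tensor_rels i s)" "y - z \<in> frag.span (tensor_rels i s)"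
    from frag.span_add[OF this] show "x - z \<in> frag.span (tensor_rels i s)" by simp
  qed
qed

lemma frag_additive_eqI:
  fixes f g :: "('b \<Rightarrow>\<^sub>0 int) \<Rightarrow> ('c \<Rightarrow>\<^sub>0 int)"
  assumes "\<And>u v. f (u - v) = f u - f v" "\<And>u v. g (u - v) = g u - g v"
    and "\<And>b. f (frag_of b) = g (frag_of b)"
  shows "f u = g u"
proof -
  have z: "f 0 = 0" "g 0 = 0" using assms(1)[of 0 0] assms(2)[of 0 0] by simp_all
  show ?thesis
    by (rule frag_induction[of u UNIV "\<lambda>u. f u = g u", OF subset_UNIV]) (auto simp: z assms)
qed

lemma frag_span_map:
  fixes f :: "('b \<Rightarrow>\<^sub>0 int) \<Rightarrow> ('c \<Rightarrow>\<^sub>0 int)"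
  assumes diff: "\<And>u v. f (u - v) = f u - f v"
    and rel: "\<And>r. r \<in> R \<Longrightarrow> f r \<in> frag.span S" and u: "u \<in> frag.span R"
  shows "f u \<in> frag.span S"
proof -
  have z: "f 0 = 0" using diff[of 0 0] by simp
  have m: "f (- u) = - f u" for u using diff[of 0 u] z by simp
  have a: "f (u + v) = f u + f v" for u v using diff[of u "- v"] m by simp
  have cn: "f (frag_cmul (int n) u) = frag_cmul (int n) (f u)" for n u
    by (induction n) (simp_all add: z a frag_cmul_distrib)
  have c: "f (frag_cmul k u) = frag_cmul k (f u)" for k u
  proof (cases "k \<ge> 0")
    case True then show ?thesis using cn[of "nat k"] by simp
  next
    case False
    then have "int (nat (- k)) = - k" by simp
    with cn[of "nat (- k)" u] have neg: "f (frag_cmul (- k) u) = frag_cmul (- k) (f u)" by metis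
    have "f (frag_cmul k u) = f (- frag_cmul (- k) u)" by simp
    also have "\<dots> = - f (frag_cmul (- k) u)" by (rule m)
    also have "\<dots> = frag_cmul k (f u)" unfolding neg by simp
    finally show ?thesis .
  qed
  show ?thesis
  proof (rule frag.span_induct_alt[OF u, of "\<lambda>u. f u \<in> frag.span S"])
    show "f 0 \<in> frag.span S" by (simp only: z frag.span_zero)
  next
    fix k r v assume "r \<in> R" "f v \<in> frag.span S"
    then show "f (frag_cmul k r + v) \<in> frag.span S"
      unfolding a c by (auto intro!: frag.span_add frag.span_scale rel)
  qed
qed

lemma free_smult_diff: "free_smult c (u - v) = free_smult c u - free_smult c v"
  by (simp add: free_smult_def frag_extend_diff)

lemma free_smult_of [simp]: "free_smult c (frag_of (a, x)) = frag_of (a, c * x)"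
  by (simp add: free_smult_def)

lemma free_mult_diff_left: "free_mult m (u - v) w = free_mult m u w - free_mult m v w"
  by (simp add: free_mult_def frag_extend_diff)

lemma free_mult_diff_right: "free_mult m w (u - v) = free_mult m w u - free_mult m w v"
  unfolding free_mult_def frag_extend_def[of _ w]
  by (simp add: frag_extend_diff sum_subtractf[symmetric] case_prod_beta
        frag.scale_right_diff_distrib)

lemma free_mult_of [simp]:
  "free_mult m (frag_of (a, x)) (frag_of (b, y)) = frag_of (m a b, x * y)"
  by (simp add: free_mult_def)

context
  fixes incl :: "'k::field \<Rightarrow> 'f::field"
    and scale :: "'k \<Rightarrow> 'a::ab_group_add \<Rightarrow> 'a" and m :: "'a \<Rightarrow> 'a \<Rightarrow> 'a"
begin

lemma cls_eq_iff: "tensor_cong incl scale `` {u} = tensor_cong incl scale `` {v}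
    \<longleftrightarrow> u - v \<in> frag.span (tensor_rels incl scale)"
  using eq_equiv_class_iff[OF equiv_tensor_cong, of u v incl scale]
  by (simp add: tensor_cong_def)

lemma base_change_carrier_iff:
  "X \<in> alg_carrier (base_change incl scale m) \<longleftrightarrow> (\<exists>u. X = tensor_cong incl scale `` {u})"
  by (auto simp: base_change_def quotient_def)

lemma base_change_cls: "tensor_cong incl scale `` {u} \<in> alg_carrier (base_change incl scale m)"
  using base_change_carrier_iff by blast

lemma tensor_rel_memb:
  "frag_of (a + b, x) - frag_of (a, x) - frag_of (b, x) \<in> frag.span (tensor_rels incl scale)"
  "frag_of (a, x + y) - frag_of (a, x) - frag_of (a, y) \<in> frag.span (tensor_rels incl scale)"
  "frag_of (scale k a, x) - frag_of (a, incl k * x) \<in> frag.span (tensor_rels incl scale)"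
  unfolding tensor_rels_def by (rule frag.span_base, blast)+

lemma tensor_rels_cases:
  assumes "r \<in> tensor_rels incl scale"
  obtains (add_left) a b x where "r = frag_of (a + b, x) - frag_of (a, x) - frag_of (b, x)"
  | (add_right) a x y where "r = frag_of (a, x + y) - frag_of (a, x) - frag_of (a, y)"
  | (scale) k a x where "r = frag_of (scale k a, x) - frag_of (a, incl k * x)"
  using assms unfolding tensor_rels_def by blast

lemma base_change_add:
  "alg_add (base_change incl scale m) (tensor_cong incl scale `` {u}) (tensor_cong incl scale `` {v})
    = tensor_cong incl scale `` {u + v}"
proof -
  have "(\<lambda>u v. tensor_cong incl scale `` {u + v}) respects2 tensor_cong incl scale"
  proof (rule congruent2I')
    fix u u' v v'
    assume "(u, u') \<in> tensor_cong incl scale" "(v, v') \<in> tensor_cong incl scale"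
    then have "(u - u') + (v - v') \<in> frag.span (tensor_rels incl scale)"
      by (intro frag.span_add) (auto simp: tensor_cong_def)
    then show "tensor_cong incl scale `` {u + v} = tensor_cong incl scale `` {u' + v'}"
      by (simp add: cls_eq_iff algebra_simps)
  qed
  from UN_equiv_class2[OF equiv_tensor_cong equiv_tensor_cong this]
  show ?thesis by (simp add: base_change_def)
qed

lemma free_smult_span:
  assumes "u \<in> frag.span (tensor_rels incl scale)"
  shows "free_smult c u \<in> frag.span (tensor_rels incl scale)"
proof (rule frag_span_map[where f = "free_smult c", OF free_smult_diff _ assms])
  fix r :: "'a \<times> 'f \<Rightarrow>\<^sub>0 int" assume "r \<in> tensor_rels incl scale"
  then show "free_smult c r \<in> frag.span (tensor_rels incl scale)"
  proof (cases rule: tensor_rels_cases)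
    case (scale k a x)
    then show ?thesis using tensor_rel_memb(3)[of k a "c * x"]
      by (simp add: free_smult_diff mult.left_commute[of c])
  next
    case (add_left a b x)
    then show ?thesis using tensor_rel_memb(1)[of a b "c * x"]
      by (simp add: free_smult_diff)
  next
    case (add_right a x y)
    then show ?thesis using tensor_rel_memb(2)[of a "c * x" "c * y"]
      by (simp add: free_smult_diff distrib_left[of c])
  qed
qed

lemma base_change_smult:
  "alg_smult (base_change incl scale m) c (tensor_cong incl scale `` {u}) = tensor_cong incl scale `` {free_smult c u}"
proof -
  have "(\<lambda>u. tensor_cong incl scale `` {free_smult c u}) respects tensor_cong incl scale"
  proof (rule congruentI)
    fix u v assume "(u, v) \<in> tensor_cong incl scale"
    then have "free_smult c (u - v) \<in> frag.span (tensor_rels incl scale)"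
      by (intro free_smult_span) (simp add: tensor_cong_def)
    then show "tensor_cong incl scale `` {free_smult c u}
        = tensor_cong incl scale `` {free_smult c v}"
      by (simp add: cls_eq_iff free_smult_diff)
  qed
  from UN_equiv_class[OF equiv_tensor_cong this] show ?thesis by (simp add: base_change_def)
qed

end

context
  fixes incl :: "'k::field \<Rightarrow> 'f::field"
    and scale :: "'k \<Rightarrow> 'a::ab_group_add \<Rightarrow> 'a" and m :: "'a \<Rightarrow> 'a \<Rightarrow> 'a"
  assumes alg: "nonassoc_algebra scale m"
begin

interpretation A: nonassoc_algebra scale m by (rule alg)

lemma frag_span_generators:
  fixes f :: "('b \<Rightarrow>\<^sub>0 int) \<Rightarrow> ('c \<Rightarrow>\<^sub>0 int)"
  assumes diff: "\<And>u v. f (u - v) = f u - f v" and "\<And>b. f (frag_of b) \<in> frag.span S"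
  shows "f u \<in> frag.span S"
proof -
  have z: "f 0 = 0" using diff[of 0 0] by simp
  show ?thesis
    by (rule frag_induction[of u UNIV "\<lambda>u. f u \<in> frag.span S", OF subset_UNIV])
       (auto simp: z assms frag.span_zero frag.span_diff)
qed

lemma free_mult_span_left:
  assumes "u \<in> frag.span (tensor_rels incl scale)"
  shows "free_mult m u v \<in> frag.span (tensor_rels incl scale)"
proof (rule frag_span_map[where f = "\<lambda>u. free_mult m u v", OF free_mult_diff_left _ assms])
  fix r :: "'a \<times> 'f \<Rightarrow>\<^sub>0 int" assume r: "r \<in> tensor_rels incl scale"
  show "free_mult m r v \<in> frag.span (tensor_rels incl scale)"
  proof (rule frag_span_generators[where f = "free_mult m r", OF free_mult_diff_right])
    fix b :: "'a \<times> 'f"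
    obtain b1 y where b: "b = (b1, y)" by (cases b)
    show "free_mult m r (frag_of b) \<in> frag.span (tensor_rels incl scale)"
      using r
    proof (cases rule: tensor_rels_cases)
      case (add_left a a' x)
      then show ?thesis using tensor_rel_memb(1)[of "m a b1" "m a' b1" "x * y" incl scale]
        by (simp add: b free_mult_diff_left A.mult_add_left)
    next
      case (add_right a x x')
      then show ?thesis using tensor_rel_memb(2)[of "m a b1" "x * y" "x' * y" incl scale]
        by (simp add: b free_mult_diff_left distrib_right[of _ _ y])
    next
      case (scale k a x)
      then show ?thesis using tensor_rel_memb(3)[of scale k "m a b1" "x * y" incl]
        by (simp add: b free_mult_diff_left A.mult_scale_left mult.assoc)
    qed
  qed
qed

lemma free_mult_span_right:
  assumes "u \<in> frag.span (tensor_rels incl scale)"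
  shows "free_mult m v u \<in> frag.span (tensor_rels incl scale)"
proof (rule frag_span_map[where f = "free_mult m v", OF free_mult_diff_right _ assms])
  fix r :: "'a \<times> 'f \<Rightarrow>\<^sub>0 int" assume r: "r \<in> tensor_rels incl scale"
  show "free_mult m v r \<in> frag.span (tensor_rels incl scale)"
  proof (rule frag_span_generators[where f = "\<lambda>v. free_mult m v r", OF free_mult_diff_left])
    fix b :: "'a \<times> 'f"
    obtain b1 y where b: "b = (b1, y)" by (cases b)
    show "free_mult m (frag_of b) r \<in> frag.span (tensor_rels incl scale)"
      using r
    proof (cases rule: tensor_rels_cases)
      case (scale k a x)
      then show ?thesis using tensor_rel_memb(3)[of scale k "m b1 a" "y * x" incl]
        by (simp add: b free_mult_diff_right A.mult_scale_right mult.left_commute[of y])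
    next
      case (add_left a a' x)
      then show ?thesis using tensor_rel_memb(1)[of "m b1 a" "m b1 a'" "y * x" incl scale]
        by (simp add: b free_mult_diff_right A.mult_add_right)
    next
      case (add_right a x x')
      then show ?thesis using tensor_rel_memb(2)[of "m b1 a" "y * x" "y * x'" incl scale]
        by (simp add: b free_mult_diff_right distrib_left[of y])
    qed
  qed
qed

lemma base_change_mult:
  "alg_mult (base_change incl scale m) (tensor_cong incl scale `` {u}) (tensor_cong incl scale `` {v})
    = tensor_cong incl scale `` {free_mult m u v}"
proof -
  have "(\<lambda>u v. tensor_cong incl scale `` {free_mult m u v}) respects2 tensor_cong incl scale"
  proof (rule congruent2I')
    fix u u' v v'
    assume "(u, u') \<in> tensor_cong incl scale" "(v, v') \<in> tensor_cong incl scale"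
    then have "free_mult m (u - u') v + free_mult m u' (v - v')
        \<in> frag.span (tensor_rels incl scale)"
      by (intro frag.span_add free_mult_span_left free_mult_span_right)
         (auto simp: tensor_cong_def)
    then show "tensor_cong incl scale `` {free_mult m u v}
        = tensor_cong incl scale `` {free_mult m u' v'}"
      by (simp add: cls_eq_iff free_mult_diff_left free_mult_diff_right)
  qed
  from UN_equiv_class2[OF equiv_tensor_cong equiv_tensor_cong this]
  show ?thesis by (simp add: base_change_def)
qed

theorem carrier_algebra_base_change: "carrier_algebra (base_change incl scale m)"
proof -
  note ops = base_change_add base_change_smult base_change_mult cls_eq_iff
  have addl: "free_mult m (u + v) w = free_mult m u w + free_mult m v w"
    for u v w :: "'a \<times> 'f \<Rightarrow>\<^sub>0 int"
    using free_mult_diff_left[of m "u + v" v w] by (simp add: algebra_simps)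
  have addr: "free_mult m w (u + v) = free_mult m w u + free_mult m w v"
    for u v w :: "'a \<times> 'f \<Rightarrow>\<^sub>0 int"
    using free_mult_diff_right[of m w "u + v" v] by (simp add: algebra_simps)
  have adds: "free_smult c (u + v) = free_smult c u + free_smult c v"
    for c and u v :: "'a \<times> 'f \<Rightarrow>\<^sub>0 int"
    using free_smult_diff[of c "u + v" v] by (simp add: algebra_simps)
  have distr: "free_smult (c + d) u - (free_smult c u + free_smult d u)
      \<in> frag.span (tensor_rels incl scale)" for c d and u :: "'a \<times> 'f \<Rightarrow>\<^sub>0 int"
  proof (rule frag_span_generators
      [where f = "\<lambda>u. free_smult (c + d) u - (free_smult c u + free_smult d u)"])
    fix b :: "'a \<times> 'f"
    obtain b1 y where b: "b = (b1, y)" by (cases b)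
    show "free_smult (c + d) (frag_of b) - (free_smult c (frag_of b) + free_smult d (frag_of b))
        \<in> frag.span (tensor_rels incl scale)"
      using tensor_rel_memb(2)[of b1 "c * y" "d * y" incl scale]
      by (simp add: b distrib_right diff_diff_eq)
  qed (simp add: free_smult_diff algebra_simps)
  have assoc: "free_smult c (free_smult d u) = free_smult (c * d) u"
    for c d and u :: "'a \<times> 'f \<Rightarrow>\<^sub>0 int"
    by (rule frag_additive_eqI[where f = "\<lambda>u. free_smult c (free_smult d u)"])
       (auto simp: free_smult_diff mult.assoc)
  have one: "free_smult 1 u = u" for u :: "'a \<times> 'f \<Rightarrow>\<^sub>0 int"
    by (rule frag_additive_eqI[where f = "free_smult 1"]) (auto simp: free_smult_diff)
  have left: "free_mult m (free_smult c u) v = free_smult c (free_mult m u v)"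
    for c and u v :: "'a \<times> 'f \<Rightarrow>\<^sub>0 int"
  proof (rule frag_additive_eqI[where f = "\<lambda>u. free_mult m (free_smult c u) v"
      and g = "\<lambda>u. free_smult c (free_mult m u v)"])
    fix b :: "'a \<times> 'f"
    show "free_mult m (free_smult c (frag_of b)) v = free_smult c (free_mult m (frag_of b) v)"
      by (rule frag_additive_eqI[where f = "free_mult m (free_smult c (frag_of b))"
          and g = "\<lambda>v. free_smult c (free_mult m (frag_of b) v)"]; cases b)
         (auto simp: free_smult_diff free_mult_diff_right mult.assoc)
  qed (auto simp: free_smult_diff free_mult_diff_left)
  have right: "free_mult m u (free_smult c v) = free_smult c (free_mult m u v)"
    for c and u v :: "'a \<times> 'f \<Rightarrow>\<^sub>0 int"
  proof (rule frag_additive_eqI[where f = "\<lambda>u. free_mult m u (free_smult c v)"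
      and g = "\<lambda>u. free_smult c (free_mult m u v)"])
    fix b :: "'a \<times> 'f"
    show "free_mult m (frag_of b) (free_smult c v) = free_smult c (free_mult m (frag_of b) v)"
      by (rule frag_additive_eqI[where f = "\<lambda>v. free_mult m (frag_of b) (free_smult c v)"
          and g = "\<lambda>v. free_smult c (free_mult m (frag_of b) v)"]; cases b)
         (auto simp: free_smult_diff free_mult_diff_right mult.left_commute)
  qed (auto simp: free_smult_diff free_mult_diff_left)
  have zero: "\<exists>Z\<in>alg_carrier (base_change incl scale m). \<forall>X\<in>alg_carrier (base_change incl scale m).
      alg_add (base_change incl scale m) Z X = X \<and>
      (\<exists>Y\<in>alg_carrier (base_change incl scale m). alg_add (base_change incl scale m) X Y = Z)"
  proof (rule bexI[OF _ base_change_cls], rule ballI)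
    fix X assume "X \<in> alg_carrier (base_change incl scale m)"
    then obtain u where X: "X = tensor_cong incl scale `` {u}"
      by (auto simp: base_change_carrier_iff)
    have "alg_add (base_change incl scale m) (tensor_cong incl scale `` {0}) X = X"
      by (simp add: X base_change_add)
    moreover have "alg_add (base_change incl scale m) X (tensor_cong incl scale `` {- u})
        = tensor_cong incl scale `` {0}"
      by (simp add: X base_change_add)
    ultimately
    show "alg_add (base_change incl scale m) (tensor_cong incl scale `` {0}) X = X \<and>
        (\<exists>Y\<in>alg_carrier (base_change incl scale m).
          alg_add (base_change incl scale m) X Y = tensor_cong incl scale `` {0})"
      using base_change_cls[of incl scale "- u" m] by blast
  qed
  show ?thesis
  proof (rule carrier_algebra.intro, goal_cases)
    case 6 show ?case by (rule zero)
  next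
    case (8 X c d)
    then obtain u where X: "X = tensor_cong incl scale `` {u}"
      by (auto simp: base_change_carrier_iff)
    show ?case
      by (simp only: X base_change_smult base_change_add cls_eq_iff distr)
  qed (auto simp: base_change_carrier_iff ops addl addr adds assoc one left right
      add_ac frag.span_zero)
qed

end

end

theory Submission
  imports Defs
begin

text \<open>
  Choose bases of the two algebras.  An isomorphism over \<open>F\<^sub>1\<close> together with its inverse is then a pair
  of row-finite matrices \<open>P\<close>, \<open>Q\<close> over \<open>F\<^sub>1\<close>, and what makes them mutually inverse and multiplicative
  is a system of polynomial equations whose coefficients are structure constants, hence lie in \<open>K\<close>.
  Suppose a ring homomorphism from some subring of \<open>F\<^sub>1\<close> that contains \<open>K\<close> and all the entries of \<open>P\<close>
  and \<open>Q\<close> goes to the algebraic closure of \<open>K\<close> and is the identity on \<open>K\<close>.  It sends \<open>P\<close>, \<open>Q\<close> to a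
  solution of the same system; zero entries stay zero, so the rows stay finite.  Including the
  algebraic closure into \<open>F\<^sub>2\<close> turns this solution into an isomorphism over \<open>F\<^sub>2\<close>.

  What carries the proof is therefore \<open>specialization_exists\<close>, a Nullstellensatz for the set \<open>X\<close> of
  matrix entries.  This set is finite or has at most as many elements as a basis, which is where
  \<open>\<omega> \<prec> K\<close> enters.  The two cases hold for different reasons.

  If \<open>X\<close> is finite, \<open>K\<close> may be small, and the elements of \<open>X\<close> are adjoined one at a time
  (\<open>finite_specialization\<close>).  The induction needs the stronger claim that the homomorphism can be
  chosen not to vanish at a prescribed nonzero element: this keeps leading coefficients of minimal
  polynomials away from zero in the next step.

  If \<open>X\<close> is infinite, let \<open>R\<close> be the \<open>K\<close>-algebra generated by \<open>X\<close> and \<open>M\<close> a maximal ideal of \<open>R\<close>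
  (\<open>infinite_specialization\<close>).  The monomials in \<open>X\<close> span \<open>R\<close>, so its dimension is smaller than the
  cardinality of \<open>K\<close>.  An element \<open>x\<close> of \<open>R / M\<close> transcendental over \<open>K\<close> would make the inverses of
  \<open>x - c\<close>, one for each \<open>c\<close> in \<open>K\<close>, linearly independent; there are too many of them.  So
  \<open>R / M\<close> is algebraic over \<open>K\<close> and embeds into the algebraic closure.

  The translation between the tensor products and matrices is \<open>base_change_isomorphic_coord_alg\<close>:
  over any extension, the tensor product is isomorphic to the algebra of finitely supported coordinate
  vectors with the given structure constants.
\<close>

section \<open>Subrings, ideals and graphs of homomorphisms\<close>

definition is_subring :: "'r::comm_ring_1 set \<Rightarrow> bool"
  where "is_subring S \<longleftrightarrow> 1 \<in> S \<and> (\<forall>x\<in>S. \<forall>y\<in>S. x - y \<in> S \<and> x * y \<in> S)"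

definition ideal_in :: "'r::comm_ring_1 set \<Rightarrow> 'r set \<Rightarrow> bool"
  where "ideal_in R M \<longleftrightarrow> M \<subseteq> R \<and> 0 \<in> M \<and> (\<forall>x\<in>M. \<forall>y\<in>M. x - y \<in> M) \<and> (\<forall>a\<in>R. \<forall>y\<in>M. a * y \<in> M)"

text \<open>
  A homomorphism from a subring is represented by its graph, a subring of the product ring that
  meets \<open>M \<times> UNIV\<close> only in pairs with second component \<open>0\<close>; this last condition says that \<open>M\<close> is killed
  and, once \<open>0\<close> is in \<open>M\<close>, makes the relation single-valued.  In contrast to functions, graphs
  can be enlarged and united over chains without choosing values outside the domain, and working
  modulo \<open>M\<close> this way avoids the quotient ring.
\<close>

definition hom_graph :: "'r::comm_ring_1 set \<Rightarrow> ('r \<times> 's::comm_ring_1) set \<Rightarrow> bool"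
  where "hom_graph M G \<longleftrightarrow> (1, 1) \<in> G
    \<and> (\<forall>x u y v. (x, u) \<in> G \<longrightarrow> (y, v) \<in> G \<longrightarrow> (x - y, u - v) \<in> G \<and> (x * y, u * v) \<in> G)
    \<and> (\<forall>x u. (x, u) \<in> G \<longrightarrow> x \<in> M \<longrightarrow> u = 0)"

definition polys_over :: "'r::comm_ring_1 set \<Rightarrow> 'r poly set"
  where "polys_over S = {p. \<forall>i. coeff p i \<in> S}"

definition lifts_to :: "('r::comm_ring_1 \<times> 's::comm_ring_1) set \<Rightarrow> 'r poly \<Rightarrow> 's poly \<Rightarrow> bool"
  where "lifts_to G p q \<longleftrightarrow> (\<forall>i. (coeff p i, coeff q i) \<in> G)"

definition adjoin_graph ::
    "('r::comm_ring_1 \<times> 's::comm_ring_1) set \<Rightarrow> 'r \<Rightarrow> 's \<Rightarrow> ('r \<times> 's) set"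
  where "adjoin_graph G x z = {(poly p x, poly q z) | p q. lifts_to G p q}"

definition adjoin :: "'r::comm_ring_1 set \<Rightarrow> 'r \<Rightarrow> 'r set"
  where "adjoin S x = {poly p x | p. p \<in> polys_over S}"

lemma subring_closed:
  assumes "is_subring S"
  shows "0 \<in> S" "1 \<in> S" "x \<in> S \<Longrightarrow> - x \<in> S"
    "x \<in> S \<Longrightarrow> y \<in> S \<Longrightarrow> x + y \<in> S" "x \<in> S \<Longrightarrow> y \<in> S \<Longrightarrow> x - y \<in> S"
    "x \<in> S \<Longrightarrow> y \<in> S \<Longrightarrow> x * y \<in> S" "x \<in> S \<Longrightarrow> x ^ n \<in> S"
proof -
  have d: "\<And>x y. x \<in> S \<Longrightarrow> y \<in> S \<Longrightarrow> x - y \<in> S" and o: "1 \<in> S"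
    and m: "\<And>x y. x \<in> S \<Longrightarrow> y \<in> S \<Longrightarrow> x * y \<in> S"
    using assms by (auto simp: is_subring_def)
  show z: "0 \<in> S" using d[OF o o] by simp
  have u: "- x \<in> S" if "x \<in> S" for x using d[OF z that] by simp
  show "x \<in> S \<Longrightarrow> - x \<in> S" by (rule u)
  show "x \<in> S \<Longrightarrow> y \<in> S \<Longrightarrow> x + y \<in> S" using d[OF _ u, of x y] by simp
  show "1 \<in> S" "x \<in> S \<Longrightarrow> y \<in> S \<Longrightarrow> x - y \<in> S" "x \<in> S \<Longrightarrow> y \<in> S \<Longrightarrow> x * y \<in> S"
    by (auto intro: o d m)
  show "x \<in> S \<Longrightarrow> x ^ n \<in> S" by (induction n) (auto intro: o m)
qed

lemma subring_sum: "is_subring S \<Longrightarrow> (\<And>i. i \<in> I \<Longrightarrow> f i \<in> S) \<Longrightarrow> sum f I \<in> S"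
  by (induction I rule: infinite_finite_induct) (auto intro: subring_closed)

lemma subring_prod: "is_subring S \<Longrightarrow> (\<And>i. i \<in> I \<Longrightarrow> f i \<in> S) \<Longrightarrow> prod f I \<in> S"
  by (induction I rule: infinite_finite_induct) (auto intro: subring_closed)

lemma subring_poly: "is_subring S \<Longrightarrow> p \<in> polys_over S \<Longrightarrow> x \<in> S \<Longrightarrow> poly p x \<in> S"
  by (auto simp: poly_altdef polys_over_def intro!: subring_sum subring_closed(6,7))

lemma polys_over_closed:
  assumes "is_subring S"
  shows "p \<in> polys_over S \<Longrightarrow> q \<in> polys_over S \<Longrightarrow> p - q \<in> polys_over S"
    "p \<in> polys_over S \<Longrightarrow> q \<in> polys_over S \<Longrightarrow> p + q \<in> polys_over S"
    "p \<in> polys_over S \<Longrightarrow> q \<in> polys_over S \<Longrightarrow> p * q \<in> polys_over S"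
    "c \<in> S \<Longrightarrow> p \<in> polys_over S \<Longrightarrow> smult c p \<in> polys_over S"
    "c \<in> S \<Longrightarrow> monom c n \<in> polys_over S" "c \<in> S \<Longrightarrow> [:c:] \<in> polys_over S"
    "[:0, 1:] \<in> polys_over S"
  using subring_closed[OF assms]
  by (auto simp: polys_over_def coeff_mult coeff_monom coeff_pCons split: nat.splits
      intro!: subring_sum[OF assms])

lemma ideal_closed:
  assumes "ideal_in R M"
  shows "0 \<in> M" "x \<in> M \<Longrightarrow> y \<in> M \<Longrightarrow> x - y \<in> M" "x \<in> M \<Longrightarrow> y \<in> M \<Longrightarrow> x + y \<in> M"
    "a \<in> R \<Longrightarrow> y \<in> M \<Longrightarrow> a * y \<in> M" "a \<in> R \<Longrightarrow> y \<in> M \<Longrightarrow> y * a \<in> M" "y \<in> M \<Longrightarrow> y \<in> R"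
proof -
  have d: "\<And>x y. x \<in> M \<Longrightarrow> y \<in> M \<Longrightarrow> x - y \<in> M" and z: "0 \<in> M"
    and m: "\<And>a y. a \<in> R \<Longrightarrow> y \<in> M \<Longrightarrow> a * y \<in> M"
    using assms by (auto simp: ideal_in_def)
  have u: "- x \<in> M" if "x \<in> M" for x using d[OF z that] by simp
  show "x \<in> M \<Longrightarrow> y \<in> M \<Longrightarrow> x + y \<in> M" using d[OF _ u, of x y] by simp
  show "0 \<in> M" "x \<in> M \<Longrightarrow> y \<in> M \<Longrightarrow> x - y \<in> M" by (auto intro: z d)
  show "a \<in> R \<Longrightarrow> y \<in> M \<Longrightarrow> a * y \<in> M" "a \<in> R \<Longrightarrow> y \<in> M \<Longrightarrow> y * a \<in> M"
    using m[of a y] by (auto simp: mult.commute)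
  show "y \<in> M \<Longrightarrow> y \<in> R" using assms by (auto simp: ideal_in_def)
qed

lemma ideal_sum: "ideal_in R M \<Longrightarrow> (\<And>i. i \<in> I \<Longrightarrow> f i \<in> M) \<Longrightarrow> sum f I \<in> M"
  by (induction I rule: infinite_finite_induct) (auto intro: ideal_closed)

lemma hom_graph_closed:
  assumes "hom_graph M G"
  shows "(0, 0) \<in> G" "(1, 1) \<in> G"
    "(x, u) \<in> G \<Longrightarrow> (y, v) \<in> G \<Longrightarrow> (x + y, u + v) \<in> G"
    "(x, u) \<in> G \<Longrightarrow> (y, v) \<in> G \<Longrightarrow> (x - y, u - v) \<in> G"
    "(x, u) \<in> G \<Longrightarrow> (y, v) \<in> G \<Longrightarrow> (x * y, u * v) \<in> G"
    "(x, u) \<in> G \<Longrightarrow> (x ^ n, u ^ n) \<in> G"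
    "(x, u) \<in> G \<Longrightarrow> x \<in> M \<Longrightarrow> u = 0"
proof -
  have d: "\<And>x u y v. (x, u) \<in> G \<Longrightarrow> (y, v) \<in> G \<Longrightarrow> (x - y, u - v) \<in> G" and o: "(1, 1) \<in> G"
    and m: "\<And>x u y v. (x, u) \<in> G \<Longrightarrow> (y, v) \<in> G \<Longrightarrow> (x * y, u * v) \<in> G"
    and k: "\<And>x u. (x, u) \<in> G \<Longrightarrow> x \<in> M \<Longrightarrow> u = 0"
    using assms by (auto simp: hom_graph_def)
  show z: "(0, 0) \<in> G" using d[OF o o] by simp
  have u: "(- x, - u) \<in> G" if "(x, u) \<in> G" for x u using d[OF z that] by simp
  show "(x, u) \<in> G \<Longrightarrow> (y, v) \<in> G \<Longrightarrow> (x + y, u + v) \<in> G" using d[OF _ u, of x u y v] by simp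
  show "(1, 1) \<in> G" "(x, u) \<in> G \<Longrightarrow> (y, v) \<in> G \<Longrightarrow> (x - y, u - v) \<in> G"
    "(x, u) \<in> G \<Longrightarrow> (y, v) \<in> G \<Longrightarrow> (x * y, u * v) \<in> G"
    "(x, u) \<in> G \<Longrightarrow> x \<in> M \<Longrightarrow> u = 0"
    by (auto intro: o d m k)
  show "(x, u) \<in> G \<Longrightarrow> (x ^ n, u ^ n) \<in> G" by (induction n) (auto intro: o m)
qed

lemma hom_graph_sum:
  "hom_graph M G \<Longrightarrow> (\<And>i. i \<in> I \<Longrightarrow> (f i, g i) \<in> G) \<Longrightarrow> (sum f I, sum g I) \<in> G"
  by (induction I rule: infinite_finite_induct) (auto intro: hom_graph_closed)

lemma hom_graph_Domain: "hom_graph M G \<Longrightarrow> is_subring (Domain G)"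
  unfolding is_subring_def by (blast intro: hom_graph_closed)

lemma hom_graph_unique:
  assumes "hom_graph M G" "0 \<in> M" "(x, u) \<in> G" "(x, v) \<in> G"
  shows "u = v"
  using hom_graph_closed(4)[OF assms(1,3,4)] hom_graph_closed(7)[OF assms(1), of 0 "u - v"] assms(2) by simp

lemma lifts_to_closed:
  assumes "hom_graph M G"
  shows "lifts_to G p p' \<Longrightarrow> lifts_to G q q' \<Longrightarrow> lifts_to G (p + q) (p' + q')"
    "lifts_to G p p' \<Longrightarrow> lifts_to G q q' \<Longrightarrow> lifts_to G (p - q) (p' - q')"
    "lifts_to G p p' \<Longrightarrow> lifts_to G q q' \<Longrightarrow> lifts_to G (p * q) (p' * q')"
    "(c, d) \<in> G \<Longrightarrow> lifts_to G p p' \<Longrightarrow> lifts_to G (smult c p) (smult d p')"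
    "(c, d) \<in> G \<Longrightarrow> lifts_to G (monom c n) (monom d n)"
    "(c, d) \<in> G \<Longrightarrow> lifts_to G [:c:] [:d:]"
    "lifts_to G [:0, 1:] [:0, 1:]"
  using hom_graph_closed[OF assms]
  by (auto simp: lifts_to_def coeff_mult coeff_monom coeff_pCons split: nat.splits
      intro!: hom_graph_sum[OF assms])

lemma lifts_to_poly:
  assumes G: "hom_graph M G" and "lifts_to G p q" "(x, u) \<in> G"
  shows "(poly p x, poly q u) \<in> G"
proof -
  let ?n = "max (degree p) (degree q)"
  have "poly p x = (\<Sum>i\<le>?n. coeff p i * x ^ i)" "poly q u = (\<Sum>i\<le>?n. coeff q i * u ^ i)"
    unfolding poly_altdef
    by (rule sum.mono_neutral_left; auto simp: coeff_eq_0 not_le)+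
  then show ?thesis using assms
    by (auto simp: lifts_to_def intro!: hom_graph_sum[OF G] hom_graph_closed[OF G])
qed

lemma lift_exists:
  assumes G: "hom_graph M G" "p \<in> polys_over (Domain G)"
  shows "\<exists>q. lifts_to G p q"
proof -
  define h where "h c = (if c = 0 then 0 else SOME d. (c, d) \<in> G)" for c
  have "(c, h c) \<in> G" if "c \<in> Domain G" for c
    using that hom_graph_closed(1)[OF G(1)] by (auto simp: h_def intro: someI)
  then have "lifts_to G p (map_poly h p)"
    using assms by (auto simp: lifts_to_def polys_over_def coeff_map_poly h_def)
  then show ?thesis ..
qed

lemma adjoin_graph_mem: "hom_graph M G \<Longrightarrow> (x, z) \<in> adjoin_graph G x z"
  unfolding adjoin_graph_def using lifts_to_closed(7)[of M G] by force

lemma adjoin_graph_extends: "hom_graph M G \<Longrightarrow> G \<subseteq> adjoin_graph G x z"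
  unfolding adjoin_graph_def using lifts_to_closed(6)[of M G] by force

lemma Domain_adjoin_graph:
  assumes "hom_graph M G"
  shows "Domain (adjoin_graph G x z) = adjoin (Domain G) x"
proof
  show "Domain (adjoin_graph G x z) \<subseteq> adjoin (Domain G) x"
    by (force simp: adjoin_graph_def adjoin_def polys_over_def lifts_to_def)
  show "adjoin (Domain G) x \<subseteq> Domain (adjoin_graph G x z)"
    using lift_exists[OF assms] by (force simp: adjoin_graph_def adjoin_def)
qed

lemma adjoin_subring:
  assumes "is_subring S"
  shows "is_subring (adjoin S x)" "S \<subseteq> adjoin S x" "x \<in> adjoin S x"
proof -
  note c = polys_over_closed[OF assms] subring_closed[OF assms]
  show "S \<subseteq> adjoin S x" unfolding adjoin_def using c(6) by force
  then show "is_subring (adjoin S x)" unfolding is_subring_def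
  proof (intro conjI ballI)
    show "1 \<in> adjoin S x" using \<open>S \<subseteq> adjoin S x\<close> c(9) by blast
    fix a b assume "a \<in> adjoin S x" "b \<in> adjoin S x"
    then obtain p q where "p \<in> polys_over S" "q \<in> polys_over S" "a = poly p x" "b = poly q x"
      by (auto simp: adjoin_def)
    then show "a - b \<in> adjoin S x" "a * b \<in> adjoin S x"
      using c(1,3)[of p q] by (auto simp: adjoin_def simp flip: poly_diff poly_mult)
  qed
  show "x \<in> adjoin S x" unfolding adjoin_def using c(7) by force
qed

section \<open>Extending a homomorphism by one element\<close>

lemma adjoin_hom_graph:
  assumes G: "hom_graph M G"
    and kill: "\<And>p q. lifts_to G p q \<Longrightarrow> poly p x \<in> M \<Longrightarrow> poly q z = 0"
  shows "hom_graph M (adjoin_graph G x z)"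
  unfolding hom_graph_def
proof (intro conjI allI impI)
  show "(1, 1) \<in> adjoin_graph G x z"
    using adjoin_graph_extends[OF G] hom_graph_closed(2)[OF G] by blast
next
  fix a u b v assume "(a, u) \<in> adjoin_graph G x z" "(b, v) \<in> adjoin_graph G x z"
  then obtain p q p' q' where *: "lifts_to G p q" "lifts_to G p' q'"
    "a = poly p x" "u = poly q z" "b = poly p' x" "v = poly q' z"
    by (auto simp: adjoin_graph_def)
  show "(a - b, u - v) \<in> adjoin_graph G x z" "(a * b, u * v) \<in> adjoin_graph G x z"
    using lifts_to_closed(2,3)[OF G *(1,2)] by (auto simp: adjoin_graph_def * simp flip: poly_diff poly_mult)
next
  fix a u assume "(a, u) \<in> adjoin_graph G x z" "a \<in> M"
  then show "u = 0" using kill by (auto simp: adjoin_graph_def)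
qed

lemma degree_less_if_top_zero:
  assumes "degree p \<le> d" "coeff p d = 0" "0 < d" shows "degree p < d"
  using assms by (metis degree_0 leading_coeff_0_iff le_neq_implies_less)

text \<open>
  If \<open>p\<close> is a relation for \<open>x\<close> modulo \<open>M\<close> of least degree and its image \<open>q\<close> keeps that degree, then \<open>x\<close>
  may be sent to any root \<open>z\<close> of \<open>q\<close>: dividing another relation \<open>f\<close> by \<open>p\<close> leaves a remainder of smaller
  degree, whose coefficients lie in \<open>M\<close> by minimality, so the image of \<open>f\<close> is a multiple of \<open>q\<close> up to a power of
  the leading coefficient of \<open>q\<close>.
\<close>

lemma hom_graph_root:
  fixes G :: "('r::comm_ring_1 \<times> 's::idom) set"
  assumes G: "hom_graph M G" and M: "ideal_in R M" and R: "is_subring R"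
    and GR: "Domain G \<subseteq> R" and x: "x \<in> R"
    and pq: "lifts_to G p q" and px: "poly p x \<in> M" and q: "coeff q (degree p) \<noteq> 0"
    and min: "\<And>f. f \<in> polys_over (Domain G) \<Longrightarrow> poly f x \<in> M \<Longrightarrow> degree f < degree p \<Longrightarrow>
      \<forall>i. coeff f i \<in> M"
    and z: "poly q z = 0"
  shows "hom_graph M (adjoin_graph G x z)"
proof (rule adjoin_hom_graph[OF G])
  fix f f' assume "lifts_to G f f'" "poly f x \<in> M"
  then show "poly f' z = 0"
  proof (induction "degree f" arbitrary: f f' rule: less_induct)
    case less
    have fG: "f \<in> polys_over (Domain G)" using less.prems(1) by (auto simp: polys_over_def lifts_to_def)
    show ?case
    proof (cases "degree f < degree p")
      case True
      then have "\<forall>i. coeff f i \<in> M" using min fG less.prems(2) by blast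
      then have "f' = 0" using less.prems(1) hom_graph_closed(7)[OF G]
        by (auto simp: lifts_to_def poly_eq_iff)
      then show ?thesis by simp
    next
      case False
      define n d where "n = degree p" and "d = degree f"
      have nd: "n \<le> d" using False by (simp add: n_def d_def)
      have n0: "0 < n"
      proof (rule ccontr)
        \<comment> \<open>A constant p would lie in M, and its image would vanish.\<close>
        assume "\<not> 0 < n"
        then have "poly p x = coeff p 0" "degree p = 0" by (auto simp: n_def poly_altdef)
        with px q pq hom_graph_closed(7)[OF G] show False by (auto simp: lifts_to_def)
      qed
      \<comment> \<open>One step of the division of f by p; p need not be monic, so f is first multiplied by
        the leading coefficient of p.\<close>
      define h where "h = smult (coeff p n) f - monom (coeff f d) (d - n) * p"
      define h' where "h' = smult (coeff q n) f' - monom (coeff f' d) (d - n) * q"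
      have h: "lifts_to G h h'" unfolding h_def h'_def
        using less.prems(1) pq by (intro lifts_to_closed[OF G]) (auto simp: lifts_to_def)
      have "degree (smult (coeff p n) f) \<le> d" using degree_smult_le[of "coeff p n" f]
        by (simp add: d_def)
      moreover have "degree (monom (coeff f d) (d - n) * p) \<le> d"
        using degree_mult_le[of "monom (coeff f d) (d - n)" p] degree_monom_le[of "coeff f d" "d - n"] nd
        by (simp add: n_def)
      ultimately have "degree h \<le> d" unfolding h_def by (rule degree_diff_le)
      moreover have "coeff h d = 0"
        using nd by (simp add: h_def coeff_monom_mult n_def d_def mult.commute[of "lead_coeff f"])
      ultimately have deg: "degree h < degree f"
        using degree_less_if_top_zero[of h d] nd n0 by (simp add: d_def)
      have inR: "coeff p n \<in> R" "coeff f d \<in> R"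
        using pq less.prems(1) GR by (auto simp: lifts_to_def)
      have "poly h x = coeff p n * poly f x - (coeff f d * x ^ (d - n)) * poly p x"
        by (simp add: h_def poly_monom)
      also have "\<dots> \<in> M"
        using inR x px less.prems(2) by (intro ideal_closed(2,4)[OF M] subring_closed[OF R])
      finally have "poly h' z = 0" using less.hyps[OF deg h] by simp
      then have "coeff q n * poly f' z = 0" by (simp add: h'_def z)
      then show ?thesis using q by (simp add: n_def)
    qed
  qed
qed

text \<open>
  A relation of least degree with a coefficient outside \<open>M\<close> has its leading coefficient outside \<open>M\<close>,
  because a leading term with coefficient in \<open>M\<close> could be dropped.
\<close>

lemma minimal_relation:
  assumes M: "ideal_in R M" and R: "is_subring R" and S: "is_subring S" "S \<subseteq> R" and x: "x \<in> R"
    and f: "f \<in> polys_over S" "poly f x \<in> M" "coeff f i \<notin> M"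
  obtains p where "p \<in> polys_over S" "poly p x \<in> M" "lead_coeff p \<notin> M"
    "\<And>g. g \<in> polys_over S \<Longrightarrow> poly g x \<in> M \<Longrightarrow> degree g < degree p \<Longrightarrow> \<forall>i. coeff g i \<in> M"
proof -
  let ?P = "\<lambda>p. p \<in> polys_over S \<and> poly p x \<in> M \<and> (\<exists>i. coeff p i \<notin> M)"
  define p where "p = arg_min degree ?P"
  have ex: "?P f" using f by blast
  have p: "?P p" and min: "\<And>g. ?P g \<Longrightarrow> degree p \<le> degree g"
    using arg_min_nat_lemma[of ?P f degree] ex unfolding p_def by auto
  have "lead_coeff p \<notin> M"
  proof
    assume lc: "lead_coeff p \<in> M"
    define n where "n = degree p"
    define g where "g = p - monom (coeff p n) n"
    have pn: "coeff p n \<in> S" using p by (auto simp: polys_over_def)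
    have gS: "g \<in> polys_over S" unfolding g_def using p pn by (intro polys_over_closed[OF S(1)]) auto
    have "poly g x = poly p x - x ^ n * coeff p n" by (simp add: g_def poly_monom mult.commute)
    also have "\<dots> \<in> M" using p lc x unfolding n_def
      by (intro ideal_closed(2,4)[OF M] subring_closed[OF R]) auto
    finally have gx: "poly g x \<in> M" .
    obtain i where i: "coeff p i \<notin> M" using p by blast
    then have ni: "i \<noteq> n" using lc n_def by auto
    then have gi: "coeff g i \<notin> M" using i by (simp add: g_def)
    have "i \<le> n" using i ideal_closed(1)[OF M] unfolding n_def by (metis le_degree)
    then have "0 < n" using ni by simp
    moreover have "degree g \<le> n" unfolding g_def
      by (intro degree_diff_le degree_monom_le) (simp add: n_def)
    moreover have "coeff g n = 0" by (simp add: g_def)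
    ultimately have "degree g < degree p" using degree_less_if_top_zero[of g n] n_def by blast
    then show False using min[of g] gS gx gi by force
  qed
  moreover have "\<forall>i. coeff g i \<in> M" if "g \<in> polys_over S" "poly g x \<in> M" "degree g < degree p" for g
    using min[of g] that by force
  ultimately show ?thesis using that[of p] p by blast
qed

text \<open>
  If \<open>q\<close> is not constant, a root of \<open>q - 1\<close> will do.
\<close>

lemma poly_nonzero_value:
  fixes q :: "'s::alg_closed_field poly"
  assumes "q \<noteq> 0" shows "\<exists>z. poly q z \<noteq> 0"
proof (cases "degree q > 0")
  case True
  then have "degree (q + - 1) = degree q" by (intro degree_add_eq_left) simp
  then have "degree (q - 1) > 0" using True by simp
  then obtain z where "poly (q - 1) z = 0" using alg_closed_imp_poly_has_root by blast
  then show ?thesis by (intro exI[of _ z]) simp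
next
  case False
  then have "degree q = 0" by simp
  then obtain c where "q = [:c:]" by (metis degree_eq_zeroE)
  then show ?thesis using assms by auto
qed

section \<open>Finitely generated rings\<close>

lemma pseudo_division:
  assumes S: "is_subring S" and h: "h \<in> polys_over S" and f: "f \<in> polys_over S"
  shows "\<exists>k. \<exists>q\<in>polys_over S. \<exists>r\<in>polys_over S.
    smult (lead_coeff h ^ k) f = q * h + r \<and> (r = 0 \<or> degree r < degree h)"
  using f
proof (induction "degree f" arbitrary: f rule: less_induct)
  case less
  note cl = polys_over_closed[OF S] subring_closed[OF S]
  have zero: "0 \<in> polys_over S" using cl(8) by (simp add: polys_over_def)
  show ?case
  proof (cases "f = 0 \<or> degree f < degree h")
    case True
    then show ?thesis using zero less.prems
      by (intro exI[of _ 0] bexI[of _ 0] bexI[of _ f]) auto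
  next
    case False
    define d n c where "d = degree f" and "n = degree h" and "c = lead_coeff h"
    have nd: "n \<le> d" using False by (simp add: n_def d_def)
    define m where "m = monom (lead_coeff f) (d - n)"
    define g where "g = smult c f - m * h"
    have inS: "c \<in> S" "lead_coeff f \<in> S" using h less.prems by (auto simp: c_def polys_over_def)
    have m: "m \<in> polys_over S" unfolding m_def using inS by (intro cl)
    have g: "g \<in> polys_over S" unfolding g_def using inS m h less.prems by (intro cl)
    have "degree (smult c f) \<le> d" using degree_smult_le[of c f] by (simp add: d_def)
    moreover have "degree (m * h) \<le> d" unfolding m_def
      using degree_mult_le[of "monom (lead_coeff f) (d - n)" h]
        degree_monom_le[of "lead_coeff f" "d - n"] nd by (simp add: n_def)
    ultimately have dg: "degree g \<le> d" unfolding g_def by (rule degree_diff_le)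
    have cg: "coeff g d = 0"
      using nd by (simp add: g_def m_def coeff_monom_mult n_def d_def c_def mult.commute[of "lead_coeff f"])
    show ?thesis
    proof (cases "d = 0")
      case True
      then have "g = 0" using dg cg by (metis le_zero_eq leading_coeff_0_iff)
      then have "smult (c ^ 1) f = m * h + 0" by (simp add: g_def)
      then show ?thesis using m zero unfolding c_def by blast
    next
      case False
      then have "degree g < degree f" using degree_less_if_top_zero[OF dg cg] d_def by simp
      from less.hyps[OF this g] obtain k q r where kqr: "q \<in> polys_over S" "r \<in> polys_over S"
        "smult (c ^ k) g = q * h + r" "r = 0 \<or> degree r < degree h"
        unfolding c_def by blast
      have "smult (c ^ Suc k) f = smult (c ^ k) g + smult (c ^ k) m * h"
        by (simp add: g_def smult_diff_right mult.commute)
      also have "\<dots> = (q + smult (c ^ k) m) * h + r" by (simp add: kqr algebra_simps)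
      finally have "smult (c ^ Suc k) f = (q + smult (c ^ k) m) * h + r" .
      moreover have "q + smult (c ^ k) m \<in> polys_over S" using kqr inS m by (intro cl)
      ultimately show ?thesis using kqr unfolding c_def by blast
    qed
  qed
qed

text \<open>
  For \<open>x\<close> algebraic over \<open>S\<close>, every nonzero \<open>s = f(x)\<close> divides a nonzero constant \<open>c\<close> in the ring
  generated by \<open>S\<close> and \<open>x\<close>.  A homomorphism that does not vanish at \<open>c\<close> cannot vanish at \<open>s\<close>
  either, so nonvanishing at \<open>s\<close> is a condition on the restriction to \<open>S\<close>.  The constant is
  found as in the Euclidean algorithm for \<open>f\<close> and the minimal polynomial \<open>p\<close>: take
  a polynomial \<open>h\<close> of least degree whose value at \<open>x\<close> is a nonzero multiple of \<open>s\<close>.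
\<close>

lemma constant_multiple_in_adjoin:
  fixes x :: "'f::idom"
  assumes S: "is_subring S" and p: "p \<in> polys_over S" "p \<noteq> 0" "poly p x = 0"
    and min: "\<And>g. g \<in> polys_over S \<Longrightarrow> poly g x = 0 \<Longrightarrow> degree g < degree p \<Longrightarrow> g = 0"
    and f: "f \<in> polys_over S" "poly f x \<noteq> 0"
  obtains c b where "c \<in> S" "c \<noteq> 0" "b \<in> polys_over S" "c = poly b x * poly f x"
proof -
  note cl = polys_over_closed[OF S] subring_closed[OF S]
  let ?P = "\<lambda>h. h \<in> polys_over S \<and> poly h x \<noteq> 0 \<and> (\<exists>b\<in>polys_over S. poly h x = poly b x * poly f x)"
  define h where "h = arg_min degree ?P"
  have "?P f" using f cl(9) cl(6)[of 1] by (auto intro!: bexI[of _ "[:1:]"])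
  then have h: "?P h" and hmin: "\<And>g. ?P g \<Longrightarrow> degree h \<le> degree g"
    using arg_min_nat_lemma[of ?P f degree] unfolding h_def by auto
  obtain b where b: "b \<in> polys_over S" "poly h x = poly b x * poly f x" using h by blast
  have lcS: "lead_coeff h \<in> S" "lead_coeff p \<in> S" using h p by (auto simp: polys_over_def)
  \<comment> \<open>Otherwise the remainder of h modulo p would have smaller degree.\<close>
  have "degree h < degree p"
  proof -
    obtain k q r where kqr: "q \<in> polys_over S" "r \<in> polys_over S"
      "smult (lead_coeff p ^ k) h = q * p + r" "r = 0 \<or> degree r < degree p"
      using pseudo_division[OF S p(1), of h] h by blast
    have "poly (smult (lead_coeff p ^ k) h) x = poly r x" by (simp add: kqr(3) p(3))
    then have e: "poly r x = lead_coeff p ^ k * poly h x" by simp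
    then have nz: "poly r x \<noteq> 0" using p(2) h by simp
    have "poly r x = poly (smult (lead_coeff p ^ k) b) x * poly f x" by (simp add: e b(2))
    then have "?P r" using nz kqr(2) b(1) lcS cl(4)[of "lead_coeff p ^ k" b] cl(14) by blast
    then show ?thesis using hmin[of r] kqr(4) nz by auto
  qed
  \<comment> \<open>Otherwise divide p by h.  The remainder vanishes at x by minimality of h, so h would be a
    factor of p up to a constant, against the minimality of p.\<close>
  moreover have "degree h = 0"
  proof (rule ccontr)
    assume h0: "degree h \<noteq> 0"
    have "h \<noteq> 0" using h by auto
    obtain k q r where kqr: "q \<in> polys_over S" "r \<in> polys_over S"
      "smult (lead_coeff h ^ k) p = q * h + r" "r = 0 \<or> degree r < degree h"
      using pseudo_division[OF S _ p(1), of h] h by blast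
    have "poly (smult (lead_coeff h ^ k) p) x = poly q x * poly h x + poly r x" by (simp add: kqr(3))
    then have e: "poly r x = - (poly q x * poly h x)" by (simp add: p(3) eq_neg_iff_add_eq_0 add.commute)
    have "poly r x = 0"
    proof (rule ccontr)
      assume "poly r x \<noteq> 0"
      moreover have "poly r x = poly (0 - q * b) x * poly f x" by (simp add: e b(2))
      moreover have "0 - q * b \<in> polys_over S" using kqr(1) b(1) cl(3)[of q b] cl(1)[of 0 "q*b"] cl(8)
        by (auto simp: polys_over_def)
      ultimately have "?P r" using kqr(2) by blast
      then show False using hmin[of r] kqr(4) \<open>poly r x \<noteq> 0\<close> by auto
    qed
    with e have "poly q x = 0" using h by simp
    have "r = 0" using min[OF kqr(2) \<open>poly r x = 0\<close>] kqr(4) \<open>degree h < degree p\<close> by linarith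
    have "q = 0"
    proof (rule ccontr)
      assume "q \<noteq> 0"
      have "smult (lead_coeff h ^ k) p = q * h" using kqr(3) \<open>r = 0\<close> by simp
      then have "degree p = degree q + degree h"
        using \<open>q \<noteq> 0\<close> \<open>h \<noteq> 0\<close> by (metis degree_mult_eq degree_smult_eq power_not_zero leading_coeff_0_iff)
      then show False using min[OF kqr(1) \<open>poly q x = 0\<close>] h0 \<open>q \<noteq> 0\<close> by simp
    qed
    with kqr(3) \<open>r = 0\<close> \<open>h \<noteq> 0\<close> p(2) show False by simp
  qed
  ultimately obtain c where "h = [:c:]" by (metis degree_eq_zeroE)
  then have "coeff h 0 = c" "poly h x = c" by simp_all
  moreover have "coeff h 0 \<in> S" using h by (auto simp: polys_over_def)
  ultimately have "c \<in> S" "c \<noteq> 0" "c = poly b x * poly f x" using h b(2) by metis+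
  then show ?thesis using that b(1) by blast
qed

context field_extension
begin

lemma incl_diff: "incl (x - y) = incl x - incl y"
  using incl_add[of "x - y" y] by simp

lemma incl_zero: "incl 0 = 0"
  using incl_diff[of 0 0] by simp

lemma incl_zero_iff: "incl x = 0 \<longleftrightarrow> x = 0"
proof
  assume "incl x = 0"
  then show "x = 0" using incl_mult[of x "inverse x"] incl_one by (cases "x = 0") auto
qed (simp add: incl_zero)

end

lemma extension_hom_graph:
  assumes i1: "field_extension incl" and i2: "field_extension inclbar"
  shows "hom_graph {0} (range (\<lambda>k. (incl k, inclbar k)))"
proof -
  interpret i1: field_extension incl by (rule i1)
  interpret i2: field_extension inclbar by (rule i2)
  have "(incl 1, inclbar 1) \<in> range (\<lambda>k. (incl k, inclbar k))" by (rule rangeI)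
  then show ?thesis unfolding hom_graph_def
    by (auto simp: i1.incl_zero_iff i2.incl_zero_iff i1.incl_one i2.incl_one
      simp flip: i1.incl_diff i2.incl_diff i1.incl_mult i2.incl_mult)
qed

text \<open>
  The extension problem for \<open>S\<close> with nonvanishing at \<open>s\<close>, which is the statement that survives the
  induction on the number of generators.
\<close>

definition has_specialization ::
    "('k \<Rightarrow> 'f::field) \<Rightarrow> ('k \<Rightarrow> 'c::field) \<Rightarrow> 'f set \<Rightarrow> 'f \<Rightarrow> bool"
  where "has_specialization incl inclbar S s \<longleftrightarrow> (\<exists>G t. hom_graph {0} G \<and> Domain G = S
    \<and> (\<forall>k. (incl k, inclbar k) \<in> G) \<and> t \<noteq> 0 \<and> (s, t) \<in> G)"

text \<open>
  To extend from \<open>S\<close> to the ring generated by \<open>S\<close> and \<open>x\<close> without vanishing at \<open>s\<close>, it suffices that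
  the homomorphism on \<open>S\<close> does not vanish at one suitable nonzero element.  For \<open>x\<close> transcendental
  over \<open>S\<close> this is a coefficient of \<open>s\<close> as a polynomial in \<open>x\<close>, and \<open>x\<close> is sent to a value at which the
  image polynomial is nonzero.  For \<open>x\<close> algebraic it is the product of the leading coefficient of
  the minimal polynomial, which provides a root to which \<open>x\<close> can be sent, and of a constant multiple
  of \<open>s\<close>.
\<close>

lemma finite_specialization:
  fixes incl :: "'k::field \<Rightarrow> 'f::field" and inclbar :: "'k \<Rightarrow> 'c::alg_closed_field"
  assumes i1: "field_extension incl" and i2: "field_extension inclbar" and "finite X"
  shows "\<exists>S. is_subring S \<and> range incl \<subseteq> S \<and> X \<subseteq> S \<and> 
    (\<forall>s\<in>S. s \<noteq> 0 \<longrightarrow> has_specialization incl inclbar S s)"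
  using \<open>finite X\<close>
proof (induction X)
  case empty
  let ?G = "range (\<lambda>k. (incl k, inclbar k))"
  have G: "hom_graph {0} ?G" and D: "Domain ?G = range incl"
    by (rule extension_hom_graph[OF i1 i2]) auto
  have "has_specialization incl inclbar (range incl) s" if s: "s \<in> range incl" "s \<noteq> 0" for s
  proof -
    obtain k where k: "s = incl k" using s(1) by blast
    then have "inclbar k \<noteq> 0"
      using s(2) field_extension.incl_zero_iff[OF i1] field_extension.incl_zero_iff[OF i2] by simp
    then show ?thesis using k G D unfolding has_specialization_def
      by (intro exI[of _ ?G] exI[of _ "inclbar k"]) auto
  qed
  moreover have "is_subring (range incl)" using hom_graph_Domain[OF G] D by simp
  ultimately show ?case by (intro exI[of _ "range incl"]) simp
next
  case (insert x X)
  then obtain S where S: "is_subring S" "range incl \<subseteq> S" "X \<subseteq> S"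
    and ext: "\<And>s. s \<in> S \<Longrightarrow> s \<noteq> 0 \<Longrightarrow> has_specialization incl inclbar S s"
    by auto
  have M: "ideal_in (UNIV :: 'f set) {0}" and R: "is_subring (UNIV :: 'f set)"
    by (auto simp: ideal_in_def is_subring_def)
  note adj = adjoin_subring[OF S(1), of x]
  have "has_specialization incl inclbar (adjoin S x) s"
    if s: "s \<in> adjoin S x" "s \<noteq> 0" for s
  proof -
    obtain f where f: "f \<in> polys_over S" "s = poly f x" using s by (auto simp: adjoin_def)
    show ?thesis
    proof (cases "\<exists>p\<in>polys_over S. poly p x = 0 \<and> p \<noteq> 0")
      case False
      \<comment> \<open>x is transcendental over S.\<close>
      have lc: "lead_coeff f \<in> S" "lead_coeff f \<noteq> 0" using f s by (auto simp: polys_over_def)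
      from ext[OF lc] obtain G t where G: "hom_graph {0} G" "Domain G = S"
        "\<And>k. (incl k, inclbar k) \<in> G" "t \<noteq> 0" "(lead_coeff f, t) \<in> G"
        unfolding has_specialization_def by auto
      obtain f' where f': "lifts_to G f f'" using lift_exists[OF G(1)] f G(2) by blast
      then have "(lead_coeff f, coeff f' (degree f)) \<in> G" by (simp add: lifts_to_def)
      then have "f' \<noteq> 0" using hom_graph_unique[OF G(1) _ G(5)] G(4) by auto
      then obtain z where z: "poly f' z \<noteq> 0" using poly_nonzero_value by blast
      let ?G = "adjoin_graph G x z"
      have "hom_graph {0} ?G"
      proof (rule adjoin_hom_graph[OF G(1)])
        fix p q assume pq: "lifts_to G p q" "poly p x \<in> {0}"
        then have "p \<in> polys_over S" using G(2) by (auto simp: polys_over_def lifts_to_def)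
        then have "p = 0" using False pq by auto
        then have "q = 0" using pq(1) hom_graph_closed(7)[OF G(1)] by (auto simp: lifts_to_def poly_eq_iff)
        then show "poly q z = 0" by simp
      qed
      moreover have "(s, poly f' z) \<in> ?G" using f f' by (auto simp: adjoin_graph_def)
      moreover have "Domain ?G = adjoin S x" using Domain_adjoin_graph[OF G(1)] G(2) by simp
      moreover have "(incl k, inclbar k) \<in> ?G" for k
        using adjoin_graph_extends[OF G(1)] G(3) by (rule subsetD)
      ultimately show ?thesis using z unfolding has_specialization_def by blast
    next
      case True
      \<comment> \<open>x is algebraic over S.\<close>
      then obtain p0 i where "p0 \<in> polys_over S" "poly p0 x \<in> {0}" "coeff p0 i \<notin> {0}"
        by (auto simp: poly_eq_iff)
      from minimal_relation[OF M R S(1) _ _ this] obtain p where p: "p \<in> polys_over S" "poly p x = 0"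
        "lead_coeff p \<noteq> 0" and min: "\<And>g. g \<in> polys_over S \<Longrightarrow> poly g x \<in> {0} \<Longrightarrow>
          degree g < degree p \<Longrightarrow> \<forall>i. coeff g i \<in> {0}" by auto
      have min': "g = 0" if "g \<in> polys_over S" "poly g x = 0" "degree g < degree p" for g
        using min[of g] that by (auto simp: poly_eq_iff)
      obtain c b where cb: "c \<in> S" "c \<noteq> 0" "b \<in> polys_over S" "c = poly b x * s"
        using constant_multiple_in_adjoin[OF S(1) p(1) _ p(2) min' f(1)] p(3) f s by force
      have lcS: "lead_coeff p \<in> S" using p by (auto simp: polys_over_def)
      have "lead_coeff p * c \<in> S" "lead_coeff p * c \<noteq> 0"
        using lcS cb p subring_closed[OF S(1)] by auto
      from ext[OF this] obtain G t where G: "hom_graph {0} G" "Domain G = S"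
        "\<And>k. (incl k, inclbar k) \<in> G" "t \<noteq> 0" "(lead_coeff p * c, t) \<in> G"
        unfolding has_specialization_def by auto
      obtain d where d: "(c, d) \<in> G" using cb G(2) by blast
      obtain q where q: "lifts_to G p q" using lift_exists[OF G(1)] p G(2) by blast
      then have lq: "(lead_coeff p, coeff q (degree p)) \<in> G" by (simp add: lifts_to_def)
      have "t = coeff q (degree p) * d"
        using hom_graph_unique[OF G(1) _ G(5) hom_graph_closed(5)[OF G(1) lq d]] by simp
      then have nz: "coeff q (degree p) \<noteq> 0" "d \<noteq> 0" using G(4) by auto
      have "0 < degree p"
      proof (rule ccontr)
        assume "\<not> 0 < degree p"
        then show False using p(2,3) by (simp add: poly_altdef)
      qed
      then have "0 < degree q" using le_degree[OF nz(1)] by simp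
      then obtain z where z: "poly q z = 0" using alg_closed_imp_poly_has_root by blast
      let ?G = "adjoin_graph G x z"
      have G': "hom_graph {0} ?G"
        by (rule hom_graph_root[OF G(1) M R _ _ q _ nz(1) _ z]) (use p min G(2) in auto)
      have D: "Domain ?G = adjoin S x" using Domain_adjoin_graph[OF G(1)] G(2) by simp
      obtain t' where t': "(s, t') \<in> ?G" using s D by blast
      obtain b' where "lifts_to G b b'" using lift_exists[OF G(1)] cb G(2) by blast
      then have "(poly b x, poly b' z) \<in> ?G" by (auto simp: adjoin_graph_def)
      then have "(c, poly b' z * t') \<in> ?G" using hom_graph_closed(5)[OF G' _ t'] cb(4) by simp
      then have "d = poly b' z * t'"
        using hom_graph_unique[OF G' _ _ subsetD[OF adjoin_graph_extends[OF G(1)] d]] by simp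
      then have "t' \<noteq> 0" using nz(2) by auto
      moreover have "(incl k, inclbar k) \<in> ?G" for k
        using adjoin_graph_extends[OF G(1)] G(3) by (rule subsetD)
      ultimately show ?thesis using t' G' D unfolding has_specialization_def by blast
    qed
  qed
  then show ?case using adj S by (intro exI[of _ "adjoin S x"]) auto
qed

section \<open>Cardinalities of generated spaces\<close>

lemma lepoll_iff_ordLeq: "A \<lesssim> B \<longleftrightarrow> ordLeq2 (card_of A) (card_of B)"
  by (simp add: lepoll_def flip: card_of_ordLeq)

lemma UN_lepoll_infinite:
  assumes "infinite B" "I \<lesssim> B" "\<And>i. i \<in> I \<Longrightarrow> A i \<lesssim> B"
  shows "(\<Union>i\<in>I. A i) \<lesssim> B"
  using assms by (simp add: lepoll_iff_ordLeq card_of_UNION_ordLeq_infinite)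

lemma lists_lepoll_infinite:
  assumes "infinite A" shows "lists A \<lesssim> A"
proof -
  have sq: "A \<times> A \<lesssim> A"
    using card_of_Times_same_infinite[OF assms] by (simp add: lepoll_iff_ordLeq ordIso_iff_ordLeq)
  have len: "{l \<in> lists A. length l = n} \<lesssim> A" for n
  proof (induction n)
    case 0
    have "{l \<in> lists A. length l = 0} = {[]}" by auto
    then show ?case using finite_lepoll_infinite[OF assms, of "{[]}"] by simp
  next
    case (Suc n)
    let ?L = "{l \<in> lists A. length l = n}"
    have "{l \<in> lists A. length l = Suc n} = (\<lambda>(a, l). a # l) ` (A \<times> ?L)"
      by (auto simp: length_Suc_conv image_iff)
    then have "{l \<in> lists A. length l = Suc n} \<lesssim> A \<times> ?L" 
      by (intro subset_image_lepoll[where f = "\<lambda>(a, l). a # l"]) simp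
    also have "A \<times> ?L \<lesssim> A \<times> A" using Suc.IH by (intro times_lepoll_mono) simp_all
    also note sq
    finally show ?case .
  qed
  have "(UNIV :: nat set) \<lesssim> A" using assms infinite_le_lepoll by blast
  then have "(\<Union>n. {l \<in> lists A. length l = n}) \<lesssim> A" by (rule UN_lepoll_infinite[OF assms _ len])
  moreover have "(\<Union>n. {l \<in> lists A. length l = n}) = lists A" by auto
  ultimately show ?thesis by simp
qed

text \<open>
  \<open>I\<close> extends to a basis of the span of \<open>W\<close>, a maximal independent part of \<open>W\<close> is another one, and any
  two bases are equipotent.
\<close>

lemma (in vector_space) independent_lepoll_span:
  assumes "independent I" "I \<subseteq> span W"
  shows "I \<lesssim> W"
proof -
  obtain B where B: "B \<subseteq> W" "independent B" "W \<subseteq> span B"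
    using maximal_independent_subset[of W] by blast
  have sB: "span B = span W" using B span_mono span_span span_minimal subspace_span
    by (metis subset_antisym)
  obtain J where J: "I \<subseteq> J" "J \<subseteq> span W" "independent J" "span W \<subseteq> span J"
    using maximal_independent_subset_extend[OF assms(2,1)] by blast
  have "span J = span W" using J span_minimal[OF J(2) subspace_span] by blast
  then obtain f where "bij_betw f J B"
    using bij_if_span_eq_span_bases[OF J(3) B(2)] sB by auto
  then have "J \<lesssim> B" by (auto simp: lepoll_def bij_betw_def)
  then show ?thesis using B(1) J(1) subset_imp_lepoll lepoll_trans by metis
qed

section \<open>Algebras of dimension smaller than the field\<close>

text \<open>
  Maximality is stated in the form in which it is used: elements of \<open>R\<close> outside \<open>M\<close> are invertible modulo
  \<open>M\<close>.
\<close>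

definition maximal_ideal_in :: "'r::comm_ring_1 set \<Rightarrow> 'r set \<Rightarrow> bool"
  where "maximal_ideal_in R M \<longleftrightarrow> ideal_in R M \<and> 1 \<notin> M \<and> (\<forall>y\<in>R - M. \<exists>f\<in>R. f * y - 1 \<in> M)"

lemma maximal_ideal_exists:
  fixes R :: "'r::comm_ring_1 set"
  assumes R: "is_subring R"
  shows "\<exists>M. maximal_ideal_in R M"
proof -
  note rc = subring_closed[OF R]
  define \<I> where "\<I> = {I. ideal_in R I \<and> 1 \<notin> I}"
  have "\<exists>M\<in>\<I>. \<forall>I\<in>\<I>. M \<subseteq> I \<longrightarrow> I = M"
  proof (rule subset_Zorn_nonempty)
    show "\<I> \<noteq> {}" using rc(1) unfolding \<I>_def ideal_in_def by (intro ex_in_conv[THEN iffD1] exI[of _ "{0}"]) auto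
  next
    fix C assume C: "C \<noteq> {}" "subset.chain \<I> C"
    have ideal: "ideal_in R I" "1 \<notin> I" if "I \<in> C" for I
      using C(2) that by (auto simp: \<I>_def subset_chain_def)
    have "x - y \<in> \<Union>C" if xy: "x \<in> \<Union>C" "y \<in> \<Union>C" for x y
    proof -
      obtain I J where IJ: "I \<in> C" "J \<in> C" "x \<in> I" "y \<in> J" using xy by blast
      then have "I \<subseteq> J \<or> J \<subseteq> I" using C(2) by (auto simp: subset_chain_def)
      then obtain N where "N \<in> C" "x \<in> N" "y \<in> N" using IJ by blast
      then show ?thesis using ideal_closed(2)[OF ideal(1)] by blast
    qed
    then show "\<Union>C \<in> \<I>"
      using C(1) ideal ideal_closed(1,4,6) unfolding \<I>_def ideal_in_def by blast
  qed
  then obtain M where M: "ideal_in R M" "1 \<notin> M"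
    and max: "\<And>I. ideal_in R I \<Longrightarrow> 1 \<notin> I \<Longrightarrow> M \<subseteq> I \<Longrightarrow> I = M"
    unfolding \<I>_def by auto
  have "\<exists>f\<in>R. f * y - 1 \<in> M" if y: "y \<in> R" "y \<notin> M" for y
  proof -
    \<comment> \<open>The ideal generated by y and M; the sign makes the witness for maximality come out
      directly.\<close>
    define I where "I = {f * y - m | f m. f \<in> R \<and> m \<in> M}"
    have "ideal_in R I" unfolding ideal_in_def
    proof (intro conjI ballI)
      show "I \<subseteq> R" using y rc ideal_closed(6)[OF M(1)] by (auto simp: I_def)
      show "0 \<in> I" using rc(1) ideal_closed(1)[OF M(1)] by (force simp: I_def)
    next
      fix a b assume "a \<in> I" "b \<in> I"
      then obtain f m g n where *: "f \<in> R" "m \<in> M" "g \<in> R" "n \<in> M" "a = f * y - m" "b = g * y - n"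
        by (auto simp: I_def)
      have "a - b = (f - g) * y - (m - n)" unfolding *(5,6) by (simp add: algebra_simps)
      then show "a - b \<in> I" unfolding I_def
        using rc(5)[OF *(1,3)] ideal_closed(2)[OF M(1) *(2,4)] by blast
    next
      fix a b assume a: "a \<in> R" and "b \<in> I"
      then obtain f m where *: "f \<in> R" "m \<in> M" "b = f * y - m" by (auto simp: I_def)
      have "a * b = (a * f) * y - a * m" unfolding *(3) by (simp add: algebra_simps)
      then show "a * b \<in> I" unfolding I_def
        using rc(6)[OF a *(1)] ideal_closed(4)[OF M(1) a *(2)] by blast
    qed
    moreover have "M \<subseteq> I"
    proof
      fix m assume m: "m \<in> M"
      have "m = 0 * y - (0 - m)" by simp
      then show "m \<in> I" unfolding I_def
        using rc(1) ideal_closed(2)[OF M(1) ideal_closed(1)[OF M(1)] m] by blast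
    qed
    moreover have "y \<in> I"
    proof -
      have "y = 1 * y - 0" by simp
      then show ?thesis unfolding I_def using rc(2) ideal_closed(1)[OF M(1)] by blast
    qed
    ultimately have "1 \<in> I" using max[of I] y by blast
    then obtain f m where fm: "f \<in> R" "m \<in> M" "1 = f * y - m" by (auto simp: I_def)
    have "f * y - 1 = m" by (simp add: fm(3))
    then show ?thesis using fm by auto
  qed
  then show ?thesis using M unfolding maximal_ideal_in_def by blast
qed

lemma maximal_ideal_cancel:
  assumes M: "maximal_ideal_in R M" and "x \<in> R" "y \<in> R" "x * y \<in> M" "x \<notin> M"
  shows "y \<in> M"
proof -
  have I: "ideal_in R M" using M by (simp add: maximal_ideal_in_def)
  obtain f where f: "f \<in> R" "f * x - 1 \<in> M" using assms by (auto simp: maximal_ideal_in_def)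
  have "y = f * (x * y) - (f * x - 1) * y" by (simp add: algebra_simps)
  then show ?thesis using ideal_closed[OF I] f assms by metis
qed

context field_extension
begin

lemma coeff_map_poly_incl [simp]: "coeff (map_poly incl p) i = incl (coeff p i)"
  by (simp add: coeff_map_poly incl_zero)

lemma incl_sum: "incl (sum f I) = (\<Sum>i\<in>I. incl (f i))"
  by (induction I rule: infinite_finite_induct) (auto simp: incl_zero incl_add)

lemma map_poly_incl_simps:
  "map_poly incl (p + q) = map_poly incl p + map_poly incl q"
  "map_poly incl (p * q) = map_poly incl p * map_poly incl q"
  "map_poly incl (smult c p) = smult (incl c) (map_poly incl p)"
  "map_poly incl (pCons c p) = pCons (incl c) (map_poly incl p)"
  "map_poly incl 0 = 0" "map_poly incl 1 = 1"
  by (simp_all add: poly_eq_iff coeff_mult incl_sum incl_add incl_mult incl_zero incl_one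
      coeff_pCons split: nat.splits)

lemma map_poly_incl_sum: "map_poly incl (sum f I) = (\<Sum>i\<in>I. map_poly incl (f i))"
  by (induction I rule: infinite_finite_induct) (auto simp: map_poly_incl_simps)

lemma map_poly_incl_prod: "map_poly incl (prod f I) = (\<Prod>i\<in>I. map_poly incl (f i))"
  by (induction I rule: infinite_finite_induct) (auto simp: map_poly_incl_simps)

lemma incl_vector_space: "vector_space (\<lambda>k y. incl k * y)"
  by unfold_locales (simp_all add: incl_add incl_mult incl_one algebra_simps)

text \<open>
  If no polynomial relation held, every \<open>x - c\<close> with \<open>c\<close> in \<open>K\<close> would have an inverse \<open>f c\<close> modulo \<open>M\<close>.
  There are more elements \<open>c\<close> than the dimension of \<open>R\<close> allows independent vectors, so
  the \<open>f c\<close> satisfy a nontrivial linear relation, and clearing denominators in it gives the polynomial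
  relation after all.
\<close>

lemma algebraic_mod_maximal_ideal:
  assumes R: "is_subring R" "range incl \<subseteq> R" and M: "maximal_ideal_in R M"
    and W: "R \<subseteq> module.span (\<lambda>k y. incl k * y) W" "W \<prec> (UNIV :: 'k set)" and x: "x \<in> R"
  shows "\<exists>p. p \<noteq> 0 \<and> poly (map_poly incl p) x \<in> M"
proof (rule ccontr)
  assume no: "\<nexists>p. p \<noteq> 0 \<and> poly (map_poly incl p) x \<in> M"
  interpret V: vector_space "\<lambda>k y. incl k * y" by (rule incl_vector_space)
  have I: "ideal_in R M" using M by (simp add: maximal_ideal_in_def)
  note rc = subring_closed[OF R(1)]
  have inR: "incl c \<in> R" for c using R(2) by blast
  have "\<exists>f\<in>R. f * (x - incl c) - 1 \<in> M" for c
  proof -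
    have "poly (map_poly incl [:- c, 1:]) x = x - incl c"
      using incl_diff[of 0 c] by (simp add: map_poly_incl_simps incl_one incl_zero)
    moreover have "[:- c, 1:] \<noteq> 0" by simp
    ultimately have "x - incl c \<notin> M" using no by metis
    then show ?thesis using M rc(5)[OF x inR] by (auto simp: maximal_ideal_in_def)
  qed
  then obtain f where f: "\<And>c. f c \<in> R" "\<And>c. f c * (x - incl c) - 1 \<in> M" by metis
  obtain C a c0 where C: "finite C" "c0 \<in> C" "a c0 \<noteq> 0" "(\<Sum>c\<in>C. incl (a c) * f c) = 0"
  proof (cases "inj f")
    case False
    then obtain c d where cd: "c \<noteq> d" "f c = f d" by (auto simp: inj_def)
    define a :: "'k \<Rightarrow> 'k" where "a e = (if e = c then 1 else - 1)" for e
    have "incl (- 1) = - 1" using incl_diff[of 0 1] by (simp add: incl_zero incl_one)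
    then show ?thesis using that[of "{c, d}" c a] cd by (simp add: a_def incl_one)
  next
    case True
    have "V.dependent (range f)"
    proof (rule ccontr)
      assume "V.independent (range f)"
      then have "range f \<lesssim> W" using W(1) f(1) by (intro V.independent_lepoll_span) auto
      then have "(UNIV :: 'k set) \<lesssim> W" using True by simp
      then show False using W(2) by (metis lesspoll_trans1 lesspoll_not_refl)
    qed
    then obtain t u v where t: "finite t" "t \<subseteq> range f" "(\<Sum>v\<in>t. incl (u v) * v) = 0" "v \<in> t" "u v \<noteq> 0"
      unfolding V.dependent_explicit by blast
    obtain C where tC: "t = f ` C" using t(2) by (meson subset_imageE)
    have inj: "inj_on f C" using True by (rule inj_on_subset) simp
    obtain c0 where "c0 \<in> C" "v = f c0" using t(4) tC by blast
    moreover have "(\<Sum>c\<in>C. incl (u (f c)) * f c) = 0"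
      using t(3) by (simp add: tC sum.reindex[OF inj])
    moreover have "finite C" using t(1) inj tC finite_imageD by blast
    ultimately show ?thesis using that[of C c0 "u \<circ> f"] t(5) by simp
  qed
  \<comment> \<open>p is the linear relation multiplied by the product of all x - c.  It is not zero because only
    one summand survives at c0.\<close>
  define p where "p = (\<Sum>c\<in>C. smult (a c) (\<Prod>d\<in>C - {c}. [:- d, 1:]))"
  define P where "P c = (\<Prod>d\<in>C - {c}. x - incl d)" for c
  have "poly p c0 = (\<Sum>c\<in>C. a c * (\<Prod>d\<in>C - {c}. c0 - d))"
    by (simp add: p_def poly_sum poly_prod)
  also have "\<dots> = (\<Sum>c\<in>{c0}. a c * (\<Prod>d\<in>C - {c}. c0 - d))"
    using C(1,2) by (intro sum.mono_neutral_right) auto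
  finally have "poly p c0 = a c0 * (\<Prod>d\<in>C - {c0}. c0 - d)" by simp
  then have "poly p c0 \<noteq> 0" using C(1,3) by simp
  then have "p \<noteq> 0" by auto
  have ev: "poly (map_poly incl [:- d, 1:]) x = x - incl d" for d
    using incl_diff[of 0 d] by (simp add: map_poly_incl_simps incl_one incl_zero)
  have PR: "P c \<in> R" for c unfolding P_def using rc(5) x inR by (intro subring_prod[OF R(1)]) auto
  have "poly (map_poly incl p) x = (\<Sum>c\<in>C. incl (a c) * P c)"
    by (simp add: p_def P_def map_poly_incl_sum map_poly_incl_simps(3) map_poly_incl_prod poly_sum poly_prod ev
        del: map_poly_pCons)
  also have "\<dots> = (\<Sum>c\<in>C. incl (a c) * P c * (1 - f c * (x - incl c)))
      + (\<Sum>c\<in>C. incl (a c) * f c) * (\<Prod>d\<in>C. x - incl d)"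
  proof -
    have "P c * (x - incl c) = (\<Prod>d\<in>C. x - incl d)" if "c \<in> C" for c
      using prod.remove[OF C(1) that, of "\<lambda>d. x - incl d"] by (simp add: P_def mult.commute)
    then have "incl (a c) * f c * (\<Prod>d\<in>C. x - incl d) = incl (a c) * f c * (P c * (x - incl c))"
      if "c \<in> C" for c using that by simp
    then show ?thesis unfolding sum_distrib_right sum.distrib[symmetric]
      by (intro sum.cong) (simp_all add: algebra_simps)
  qed
  also have "\<dots> = (\<Sum>c\<in>C. incl (a c) * P c * (0 - (f c * (x - incl c) - 1)))" by (simp add: C(4))
  also have "\<dots> \<in> M"
    using f inR PR rc(6) ideal_closed(1,2,4)[OF I] by (intro ideal_sum[OF I]) blast
  finally show False using no \<open>p \<noteq> 0\<close> by blast
qed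

end

text \<open>
  The span of all monomials in \<open>X\<close> is the \<open>K\<close>-algebra generated by \<open>X\<close>; in this form its dimension is
  bounded by the number of monomials.
\<close>

lemma (in field_extension) span_of_monoid:
  assumes W: "W = prod_list ` lists X"
  defines "R \<equiv> module.span (\<lambda>k y. incl k * y) W"
  shows "is_subring R" "range incl \<subseteq> R" "X \<subseteq> R"
proof -
  interpret V: vector_space "\<lambda>k y. incl k * y" by (rule incl_vector_space)
  have one: "1 \<in> W" unfolding W by (rule image_eqI[of _ _ "[]"]) auto
  have prod: "v * w \<in> W" if vw: "v \<in> W" "w \<in> W" for v w
  proof -
    obtain k l where "v = prod_list k" "w = prod_list l" "k \<in> lists X" "l \<in> lists X"
      using vw unfolding W by blast
    then show ?thesis unfolding W by (intro image_eqI[of _ _ "k @ l"]) auto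
  qed
  have Rmult: "a * b \<in> R" if ab: "a \<in> R" "b \<in> R" for a b
    using ab(1) unfolding R_def
  proof (induction rule: V.span_induct_alt)
    case base
    then show ?case by (simp add: V.span_zero)
  next
    case (step c v a)
    have "v * b \<in> V.span W" using ab(2) unfolding R_def
    proof (induction rule: V.span_induct_alt)
      case base
      then show ?case by (simp add: V.span_zero)
    next
      case (step d w b)
      have "v * (incl d * w + b) = incl d * (v * w) + v * b" by (simp add: algebra_simps)
      then show ?case using V.span_add[OF V.span_scale[OF V.span_base[OF prod[OF \<open>v \<in> W\<close> step(1)]]] step(2)]
        by simp
    qed
    moreover have "(incl c * v + a) * b = incl c * (v * b) + a * b" by (simp add: algebra_simps)
    ultimately show ?case using step(2) V.span_add V.span_scale by metis
  qed
  have R1: "1 \<in> R" unfolding R_def using one by (rule V.span_base)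
  show "is_subring R" unfolding is_subring_def
    using R1 Rmult V.span_diff unfolding R_def by blast
  show "range incl \<subseteq> R" using V.span_scale[OF R1[unfolded R_def]] by (auto simp: R_def)
  have "X \<subseteq> W"
  proof
    fix x assume "x \<in> X"
    then show "x \<in> W" unfolding W by (intro image_eqI[of _ _ "[x]"]) auto
  qed
  then show "X \<subseteq> R" unfolding R_def using V.span_superset by blast
qed

text \<open>
  A polynomial relation for \<open>y\<close> over \<open>K\<close> modulo \<open>M\<close> can be divided by powers of \<open>y\<close> as long as \<open>y\<close> is
  invertible modulo \<open>M\<close>, until its constant term is nonzero.  If \<open>y\<close> is sent to \<open>0\<close>, then
  so is this constant term, which is impossible.
\<close>

lemma hom_graph_exact_kernel:
  fixes incl :: "'k::field \<Rightarrow> 'f::field" and inclbar :: "'k \<Rightarrow> 'c::field"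
  assumes i1: "field_extension incl" and i2: "field_extension inclbar"
    and G: "hom_graph M G" "Domain G \<subseteq> R" "\<And>k. (incl k, inclbar k) \<in> G"
    and M: "maximal_ideal_in R M" and R: "is_subring R"
    and alg: "p \<noteq> 0" "poly (map_poly incl p) y \<in> M" and y: "(y, 0) \<in> G"
  shows "y \<in> M"
proof (rule ccontr)
  assume "y \<notin> M"
  interpret i1: field_extension incl by (rule i1)
  interpret i2: field_extension inclbar by (rule i2)
  have lift: "lifts_to G (map_poly incl p) (map_poly inclbar p)" for p
    using G(3) by (simp add: lifts_to_def)
  have yR: "y \<in> R" using y G(2) by blast
  show False using alg
  proof (induction p)
    case 0
    then show ?case by simp
  next
    case (pCons c p)
    have e: "(poly (map_poly incl (pCons c p)) y, poly (map_poly inclbar (pCons c p)) 0) \<in> G"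
      by (rule lifts_to_poly[OF G(1) lift y])
    have "poly (map_poly inclbar (pCons c p)) 0 = 0"
      using hom_graph_closed(7)[OF G(1) e pCons.prems(2)] .
    then have c: "c = 0" by (simp add: i2.map_poly_incl_simps i2.incl_zero_iff)
    then have "p \<noteq> 0" using pCons.prems by simp
    have "(poly (map_poly incl p) y, poly (map_poly inclbar p) 0) \<in> G"
      by (rule lifts_to_poly[OF G(1) lift y])
    then have "poly (map_poly incl p) y \<in> R" using G(2) by blast
    moreover have "y * poly (map_poly incl p) y \<in> M"
      using pCons.prems(2) by (simp add: c i1.map_poly_incl_simps i1.incl_zero)
    ultimately have "poly (map_poly incl p) y \<in> M"
      using maximal_ideal_cancel[OF M yR _ _ \<open>y \<notin> M\<close>] by blast
    then show ?case using pCons.IH \<open>p \<noteq> 0\<close> by blast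
  qed
qed

lemma hom_graph_Union_chain:
  assumes "C \<noteq> {}" "\<And>G. G \<in> C \<Longrightarrow> hom_graph M G" "\<And>G H. G \<in> C \<Longrightarrow> H \<in> C \<Longrightarrow> G \<subseteq> H \<or> H \<subseteq> G"
  shows "hom_graph M (\<Union>C)"
  unfolding hom_graph_def
proof (intro conjI allI impI)
  show "(1, 1) \<in> \<Union>C" using assms(1) hom_graph_closed(2)[OF assms(2)] by blast
next
  fix x u y v assume "(x, u) \<in> \<Union>C" "(y, v) \<in> \<Union>C"
  then obtain G H where "G \<in> C" "H \<in> C" "(x, u) \<in> G" "(y, v) \<in> H" by blast
  then obtain N where N: "N \<in> C" "(x, u) \<in> N" "(y, v) \<in> N" using assms(3)[of G H] by blast
  show "(x - y, u - v) \<in> \<Union>C" "(x * y, u * v) \<in> \<Union>C"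
    using hom_graph_closed(4,5)[OF assms(2)[OF N(1)] N(2,3)] N(1) by auto
next
  fix x u assume "(x, u) \<in> \<Union>C" "x \<in> M"
  then show "u = 0" using hom_graph_closed(7)[OF assms(2)] by blast
qed

text \<open>
  Since \<open>R\<close> is algebraic over \<open>K\<close> modulo \<open>M\<close>, a maximal homomorphism on a subring of \<open>R\<close> that kills \<open>M\<close>
  is defined on all of \<open>R\<close>: its kernel is exactly the part of \<open>M\<close> in its domain, so the leading
  coefficient of the minimal relation of a further element does not vanish, and the
  image of this relation has a root.
\<close>

lemma infinite_specialization:
  fixes incl :: "'k::field \<Rightarrow> 'f::field" and inclbar :: "'k \<Rightarrow> 'c::alg_closed_field"
  assumes i1: "field_extension incl" and i2: "field_extension inclbar"
    and X: "infinite X" "X \<prec> (UNIV :: 'k set)"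
  obtains M G where "0 \<in> M" "hom_graph M G" "\<And>k. (incl k, inclbar k) \<in> G" "X \<subseteq> Domain G"
proof -
  interpret i1: field_extension incl by (rule i1)
  interpret i2: field_extension inclbar by (rule i2)
  define W where "W = prod_list ` lists X"
  define R where "R = module.span (\<lambda>k y. incl k * y) W"
  have R: "is_subring R" "range incl \<subseteq> R" "X \<subseteq> R"
    using i1.span_of_monoid[OF W_def] by (simp_all add: R_def)
  note rc = subring_closed[OF R(1)]
  have "W \<lesssim> X" unfolding W_def using lists_lepoll_infinite[OF X(1)] image_lepoll lepoll_trans by blast
  then have W: "W \<prec> (UNIV :: 'k set)" using X(2) lesspoll_trans1 by blast
  obtain M where M: "maximal_ideal_in R M" using maximal_ideal_exists[OF R(1)] by blast
  have I: "ideal_in R M" and M1: "1 \<notin> M" using M by (auto simp: maximal_ideal_in_def)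
  have alg: "\<exists>p. p \<noteq> 0 \<and> poly (map_poly incl p) y \<in> M" if "y \<in> R" for y
    using i1.algebraic_mod_maximal_ideal[OF R(1,2) M _ W that] by (simp add: R_def)
  have KM: "k = 0" if "incl k \<in> M" for k
  proof (rule ccontr)
    assume "k \<noteq> 0"
    then have "incl (inverse k) * incl k = 1" by (simp add: i1.incl_one flip: i1.incl_mult)
    then show False using ideal_closed(4)[OF I _ that, of "incl (inverse k)"] R(2) M1 by auto
  qed
  let ?G0 = "range (\<lambda>k. (incl k, inclbar k))"
  define \<G> where "\<G> = {G. hom_graph M G \<and> Domain G \<subseteq> R \<and> ?G0 \<subseteq> G}"
  have "\<exists>G\<in>\<G>. \<forall>H\<in>\<G>. G \<subseteq> H \<longrightarrow> H = G"
  proof (rule subset_Zorn_nonempty)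
    have "hom_graph M ?G0"
      using extension_hom_graph[OF i1 i2] KM i2.incl_zero unfolding hom_graph_def by auto
    then have "?G0 \<in> \<G>" using R(2) unfolding \<G>_def by auto
    then show "\<G> \<noteq> {}" by blast
  next
    fix C assume C: "C \<noteq> {}" "subset.chain \<G> C"
    have chain: "G \<subseteq> H \<or> H \<subseteq> G" if "G \<in> C" "H \<in> C" for G H
      using C(2) that unfolding subset_chain_def by blast
    have "C \<subseteq> \<G>" using C(2) unfolding subset_chain_def by blast
    then have mem: "hom_graph M G \<and> Domain G \<subseteq> R \<and> ?G0 \<subseteq> G" if "G \<in> C" for G
      using that unfolding \<G>_def by blast
    have "hom_graph M (\<Union>C)" using mem by (intro hom_graph_Union_chain[OF C(1) _ chain]) blast+
    moreover have "Domain (\<Union>C) \<subseteq> R" using mem by blast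
    moreover have "?G0 \<subseteq> \<Union>C" using C(1) mem by blast
    ultimately show "\<Union>C \<in> \<G>" by (simp add: \<G>_def)
  qed
  then obtain G where G\<G>: "G \<in> \<G>" and max: "\<And>H. H \<in> \<G> \<Longrightarrow> G \<subseteq> H \<Longrightarrow> H = G" by blast
  have G: "hom_graph M G" "Domain G \<subseteq> R" "?G0 \<subseteq> G" using G\<G> unfolding \<G>_def by blast+
  have K: "(incl k, inclbar k) \<in> G" for k using G(3) by blast
  have "R \<subseteq> Domain G"
  proof
    fix x assume x: "x \<in> R"
    obtain p0 where p0: "p0 \<noteq> 0" "poly (map_poly incl p0) x \<in> M" using alg[OF x] by blast
    have p0G: "map_poly incl p0 \<in> polys_over (Domain G)" using K by (auto simp: polys_over_def)
    have lc0: "coeff (map_poly incl p0) (degree p0) \<notin> M"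
      using KM[of "lead_coeff p0"] p0(1) by auto
    from minimal_relation[OF I R(1) hom_graph_Domain[OF G(1)] G(2) x p0G p0(2) lc0]
    obtain p where p: "p \<in> polys_over (Domain G)" "poly p x \<in> M" "lead_coeff p \<notin> M"
      and min: "\<And>g. g \<in> polys_over (Domain G) \<Longrightarrow> poly g x \<in> M \<Longrightarrow> degree g < degree p \<Longrightarrow>
        \<forall>i. coeff g i \<in> M"
      by metis
    obtain q where q: "lifts_to G p q" using lift_exists[OF G(1) p(1)] by blast
    then have lq: "(lead_coeff p, coeff q (degree p)) \<in> G" by (simp add: lifts_to_def)
    have lR: "lead_coeff p \<in> R" using lq G(2) by blast
    have nz: "coeff q (degree p) \<noteq> 0"
    proof
      assume "coeff q (degree p) = 0"
      then have "(lead_coeff p, 0) \<in> G" using lq by simp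
      with alg[OF lR] have "lead_coeff p \<in> M"
        using hom_graph_exact_kernel[OF i1 i2 G(1,2) K M R(1)] by blast
      with p(3) show False by blast
    qed
    have "0 < degree p"
    proof (rule ccontr)
      assume "\<not> 0 < degree p"
      then show False using p(2,3) by (simp add: poly_altdef)
    qed
    then have "0 < degree q" using le_degree[OF nz] by simp
    then obtain z where z: "poly q z = 0" using alg_closed_imp_poly_has_root by blast
    let ?H = "adjoin_graph G x z"
    have H: "hom_graph M ?H"
      by (rule hom_graph_root[OF G(1) I R(1) G(2) x q p(2) nz min z])
    have "Domain ?H \<subseteq> R"
    proof -
      have "polys_over (Domain G) \<subseteq> polys_over R" using G(2) by (auto simp: polys_over_def)
      then show ?thesis unfolding Domain_adjoin_graph[OF G(1)]
        using subring_poly[OF R(1) _ x] by (auto simp: adjoin_def)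
    qed
    then have "?H \<in> \<G>"
      using H order_trans[OF G(3) adjoin_graph_extends[OF G(1)]] unfolding \<G>_def by blast
    then have "?H = G" using max adjoin_graph_extends[OF G(1)] by blast
    then show "x \<in> Domain G" using adjoin_graph_mem[OF G(1), of x z] by blast
  qed
  then show ?thesis using that[OF ideal_closed(1)[OF I] G(1) K] R(3) by blast
qed

definition ring_hom_on :: "'r::comm_ring_1 set \<Rightarrow> ('r \<Rightarrow> 's::comm_ring_1) \<Rightarrow> bool"
  where "ring_hom_on S h \<longleftrightarrow> is_subring S \<and> h 1 = 1 \<and>
    (\<forall>x\<in>S. \<forall>y\<in>S. h (x + y) = h x + h y \<and> h (x * y) = h x * h y)"

text \<open>
  A Nullstellensatz in finitely many, or infinitely many but fewer than \<open>|K|\<close>, variables: the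
  elements of \<open>X\<close>, seen as the coordinates of a point over an extension field, specialize to the
  coordinates of a point over an algebraically closed extension of \<open>K\<close>.
\<close>

theorem specialization_exists:
  fixes incl :: "'k::field \<Rightarrow> 'f::field" and inclbar :: "'k \<Rightarrow> 'c::alg_closed_field"
  assumes i1: "field_extension incl" and i2: "field_extension inclbar"
    and X: "finite X \<or> X \<prec> (UNIV :: 'k set)"
  obtains S h where "ring_hom_on S h" "range incl \<subseteq> S" "X \<subseteq> S" "\<And>k. h (incl k) = inclbar k"
proof -
  obtain M G where G: "0 \<in> M" "hom_graph M G" "\<And>k. (incl k, inclbar k) \<in> G" "X \<subseteq> Domain G"
  proof (cases "finite X")
    case True
    from finite_specialization[OF i1 i2 this] obtain S where S: "is_subring S" "X \<subseteq> S"
      and ext: "\<And>s. s \<in> S \<Longrightarrow> s \<noteq> 0 \<Longrightarrow> has_specialization incl inclbar S s" by auto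
    have "has_specialization incl inclbar S 1" using ext subring_closed(2)[OF S(1)] by simp
    then obtain G where "hom_graph {0} G" "Domain G = S" "\<And>k. (incl k, inclbar k) \<in> G"
      unfolding has_specialization_def by auto
    then show ?thesis using that[of "{0}" G] S(2) by simp
  next
    case False
    with X have "X \<prec> (UNIV :: 'k set)" by simp
    from infinite_specialization[OF i1 i2 False this] that show ?thesis by metis
  qed
  define h where "h x = (THE u. (x, u) \<in> G)" for x
  have h: "h x = u" if "(x, u) \<in> G" for x u
    unfolding h_def using that hom_graph_unique[OF G(2,1)] by (intro the_equality) blast+
  have hG: "(x, h x) \<in> G" if "x \<in> Domain G" for x using that h by blast
  have "ring_hom_on (Domain G) h"
    unfolding ring_hom_on_def using hom_graph_Domain[OF G(2)]
    by (auto intro!: h hom_graph_closed[OF G(2)] hG)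
  moreover have "range incl \<subseteq> Domain G" using G(3) by blast
  ultimately show ?thesis using that[of "Domain G" h] G(4) h[OF G(3)] by simp
qed

section \<open>Coordinate algebras\<close>

abbreviation smul :: "'f::comm_ring_1 \<Rightarrow> ('i \<Rightarrow>\<^sub>0 'f) \<Rightarrow> ('i \<Rightarrow>\<^sub>0 'f)"
  where "smul c \<equiv> Poly_Mapping.map ((*) c)"

text \<open>
  The linear map with prescribed values on the standard basis vectors, that is, multiplication of a
  row vector by the row-finite matrix \<open>f\<close>.
\<close>

definition lin :: "('i \<Rightarrow> 'j \<Rightarrow>\<^sub>0 'f::comm_ring_1) \<Rightarrow> ('i \<Rightarrow>\<^sub>0 'f) \<Rightarrow> ('j \<Rightarrow>\<^sub>0 'f)"
  where "lin f v = (\<Sum>i\<in>Poly_Mapping.keys v. smul (Poly_Mapping.lookup v i) (f i))"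

definition bilin :: "('i \<Rightarrow> 'i \<Rightarrow> 'j \<Rightarrow>\<^sub>0 'f::comm_ring_1) \<Rightarrow> ('i \<Rightarrow>\<^sub>0 'f) \<Rightarrow> ('i \<Rightarrow>\<^sub>0 'f) \<Rightarrow> ('j \<Rightarrow>\<^sub>0 'f)"
  where "bilin f v w = lin (\<lambda>i. lin (f i) w) v"

lemma lookup_map_zero: "h 0 = 0 \<Longrightarrow> Poly_Mapping.lookup (Poly_Mapping.map h v) i = h (Poly_Mapping.lookup v i)"
  by (simp add: map.rep_eq when_def)

lemma lookup_smul [simp]: "Poly_Mapping.lookup (smul c v) i = c * Poly_Mapping.lookup v i"
  by (simp add: lookup_map_zero)

lemma smul_simps:
  "smul c (v + w) = smul c v + smul c w" "smul (c + d) v = smul c v + smul d v"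
  "smul c (v - w) = smul c v - smul c w" "smul (c - d) v = smul c v - smul d v"
  "smul c (smul d v) = smul (c * d) v" "smul 1 v = v" "smul 0 v = 0" "smul c 0 = 0"
  by (rule poly_mapping_eqI; simp add: lookup_add lookup_minus algebra_simps)+

lemma smul_sum: "smul c (sum f I) = (\<Sum>i\<in>I. smul c (f i))"
  by (induction I rule: infinite_finite_induct) (auto simp: smul_simps)

lemma keys_smul: "Poly_Mapping.keys (smul c v) \<subseteq> Poly_Mapping.keys v"
  by (auto simp: in_keys_iff)

lemma lin_superset:
  assumes "finite I" "Poly_Mapping.keys v \<subseteq> I"
  shows "lin f v = (\<Sum>i\<in>I. smul (Poly_Mapping.lookup v i) (f i))"
  unfolding lin_def
  by (rule sum.mono_neutral_left) (use assms in \<open>auto simp: in_keys_iff smul_simps\<close>)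

lemma lin_add: "lin f (v + w) = lin f v + lin f w"
proof -
  let ?I = "Poly_Mapping.keys v \<union> Poly_Mapping.keys w"
  have "finite ?I" "Poly_Mapping.keys (v + w) \<subseteq> ?I" by (simp_all add: keys_add)
  then show ?thesis
    by (simp add: lin_superset[of ?I] lookup_add smul_simps sum.distrib)
qed

lemma lin_smul: "lin f (smul c v) = smul c (lin f v)"
proof -
  have "lin f (smul c v) = (\<Sum>i\<in>Poly_Mapping.keys v. smul (c * Poly_Mapping.lookup v i) (f i))"
    using lin_superset[OF finite_keys keys_smul, of f c v] by simp
  then show ?thesis by (simp add: lin_def smul_sum smul_simps)
qed

lemma lin_zero [simp]: "lin f 0 = 0"
  by (simp add: lin_def)

lemma lin_diff: "lin f (v - w) = lin f v - lin f w"
  using lin_add[of f "v - w" w] by simp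

lemma lin_sum: "lin f (sum g I) = (\<Sum>i\<in>I. lin f (g i))"
  by (induction I rule: infinite_finite_induct) (auto simp: lin_add)

lemma lin_single [simp]: "lin f (Poly_Mapping.single i c) = smul c (f i)"
  by (simp add: lin_def smul_simps)

lemma lin_cong: "(\<And>i. i \<in> Poly_Mapping.keys v \<Longrightarrow> f i = g i) \<Longrightarrow> lin f v = lin g v"
  by (simp add: lin_def)

lemma lin_lin: "lin f (lin g v) = lin (\<lambda>i. lin f (g i)) v"
  unfolding lin_def[of g v] lin_sum lin_smul by (simp add: lin_def)

lemma lin_of_single [simp]: "lin (\<lambda>i. Poly_Mapping.single i 1) v = v"
proof (rule poly_mapping_eqI)
  fix k
  have "Poly_Mapping.lookup (lin (\<lambda>i. Poly_Mapping.single i 1) v) k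
      = (\<Sum>i\<in>Poly_Mapping.keys v. if i = k then Poly_Mapping.lookup v i else 0)"
    by (simp add: lin_def lookup_sum lookup_single when_def if_distrib cong: if_cong)
  then show "Poly_Mapping.lookup (lin (\<lambda>i. Poly_Mapping.single i 1) v) k = Poly_Mapping.lookup v k"
    by (simp add: in_keys_iff)
qed

lemma lin_swap: "lin (\<lambda>i. lin (g i) w) v = lin (\<lambda>j. lin (\<lambda>i. g i j) v) w"
  unfolding lin_def smul_sum smul_simps
  by (subst sum.swap) (simp add: mult.commute)

lemma lin_smul_fun: "lin (\<lambda>i. smul c (f i)) v = smul c (lin f v)"
  by (simp add: lin_def smul_sum smul_simps mult.commute)

lemma lin_add_fun: "lin (\<lambda>i. f i + g i) v = lin f v + lin g v"
  by (simp add: lin_def smul_simps sum.distrib)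

lemma keys_lin:
  assumes "\<And>i. i \<in> Poly_Mapping.keys v \<Longrightarrow> Poly_Mapping.keys (f i) \<subseteq> B"
  shows "Poly_Mapping.keys (lin f v) \<subseteq> B"
  using keys_sum[of "\<lambda>i. smul (Poly_Mapping.lookup v i) (f i)" "Poly_Mapping.keys v"] assms keys_smul
  unfolding lin_def by fast

lemma bilin_simps:
  "bilin f v (w + w') = bilin f v w + bilin f v w'"
  "bilin f (v - v') w = bilin f v w - bilin f v' w"
  "bilin f (smul c v) w = smul c (bilin f v w)" "bilin f v (smul c w) = smul c (bilin f v w)"
  by (simp_all add: bilin_def lin_add lin_diff lin_smul lin_add_fun lin_smul_fun)

lemma bilin_diff_right: "bilin f v (w - w') = bilin f v w - bilin f v w'"
  using bilin_simps(1)[of f v "w - w'" w'] by simp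

lemma bilin_lin: "bilin f (lin p v) (lin p w) = bilin (\<lambda>i j. bilin f (p i) (p j)) v w"
proof -
  have "bilin f (lin p v) (lin p w) = lin (\<lambda>i. lin (\<lambda>k. lin (\<lambda>j. lin (f k) (p j)) w) (p i)) v"
    by (simp add: bilin_def lin_lin)
  also have "\<dots> = lin (\<lambda>i. lin (\<lambda>j. lin (\<lambda>k. lin (f k) (p j)) (p i)) w) v"
    by (subst lin_swap) (rule refl)
  finally show ?thesis by (simp add: bilin_def)
qed

lemma lin_bilin: "lin p (bilin f v w) = bilin (\<lambda>i j. lin p (f i j)) v w"
  by (simp add: bilin_def lin_lin)

text \<open>
  The algebra with basis \<open>B\<close> and structure constants \<open>\<gamma>\<close>: the coordinates of the product of the basis
  elements \<open>i\<close> and \<open>j\<close> are \<open>\<gamma> i j\<close>.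
\<close>

definition coord_alg :: "'i set \<Rightarrow> ('i \<Rightarrow> 'i \<Rightarrow> 'i \<Rightarrow>\<^sub>0 'f::field) \<Rightarrow> ('f, 'i \<Rightarrow>\<^sub>0 'f) alg"
  where "coord_alg B \<gamma> = \<lparr> alg_carrier = {v. Poly_Mapping.keys v \<subseteq> B}, alg_add = (+),
    alg_smult = smul, alg_mult = bilin \<gamma> \<rparr>"

text \<open>
  The polynomial equations that express an isomorphism between coordinate algebras: \<open>P\<close> and \<open>Q\<close> are
  mutually inverse and \<open>P\<close> respects products of basis elements.
\<close>

definition iso_matrices ::
    "'i set \<Rightarrow> ('i \<Rightarrow> 'i \<Rightarrow> 'i \<Rightarrow>\<^sub>0 'f::field) \<Rightarrow> 'j set \<Rightarrow> ('j \<Rightarrow> 'j \<Rightarrow> 'j \<Rightarrow>\<^sub>0 'f) \<Rightarrow>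
      ('i \<Rightarrow> 'j \<Rightarrow>\<^sub>0 'f) \<Rightarrow> ('j \<Rightarrow> 'i \<Rightarrow>\<^sub>0 'f) \<Rightarrow> bool"
  where "iso_matrices A \<gamma> B \<delta> P Q \<longleftrightarrow>
    (\<forall>a\<in>A. Poly_Mapping.keys (P a) \<subseteq> B \<and> lin Q (P a) = Poly_Mapping.single a 1) \<and>
    (\<forall>b\<in>B. Poly_Mapping.keys (Q b) \<subseteq> A \<and> lin P (Q b) = Poly_Mapping.single b 1) \<and>
    (\<forall>a\<in>A. \<forall>a'\<in>A. lin P (\<gamma> a a') = bilin \<delta> (P a) (P a'))"

lemma linear_eq_lin:
  assumes add: "\<And>v w. Poly_Mapping.keys v \<subseteq> A \<Longrightarrow> Poly_Mapping.keys w \<subseteq> A \<Longrightarrow> \<phi> (v + w) = \<phi> v + \<phi> w"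
    and smul: "\<And>c v. Poly_Mapping.keys v \<subseteq> A \<Longrightarrow> \<phi> (smul c v) = smul c (\<phi> v)"
    and v: "Poly_Mapping.keys v \<subseteq> A"
  shows "\<phi> v = lin (\<lambda>a. \<phi> (Poly_Mapping.single a 1)) v"
proof -
  have z: "\<phi> 0 = 0" using smul[of 0 0] by (simp add: smul_simps)
  have s: "\<phi> (sum g I) = (\<Sum>i\<in>I. \<phi> (g i))" if "finite I" "\<And>i. i \<in> I \<Longrightarrow> Poly_Mapping.keys (g i) \<subseteq> A" for g and I :: "'a set"
    using that
  proof (induction I)
    case empty
    show ?case by (simp add: z)
  next
    case (insert i I)
    have "Poly_Mapping.keys (sum g I) \<subseteq> A" using insert.prems keys_sum[of g I] by blast
    then show ?case using insert by (simp add: add)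
  qed
  have "\<phi> v = \<phi> (lin (\<lambda>a. Poly_Mapping.single a 1) v)" by simp
  also have "\<dots> = (\<Sum>a\<in>Poly_Mapping.keys v. \<phi> (smul (Poly_Mapping.lookup v a) (Poly_Mapping.single a 1)))"
    unfolding lin_def using v by (intro s) (auto split: if_splits)
  also have "\<dots> = lin (\<lambda>a. \<phi> (Poly_Mapping.single a 1)) v"
    unfolding lin_def by (rule sum.cong) (use v in \<open>auto simp: smul simp del: map_single\<close>)
  finally show ?thesis .
qed

lemma coord_iso_imp_matrices:
  assumes iso: "alg_isomorphic (coord_alg A \<gamma>) (coord_alg B \<delta>)"
    and \<gamma>: "\<And>a a'. a \<in> A \<Longrightarrow> a' \<in> A \<Longrightarrow> Poly_Mapping.keys (\<gamma> a a') \<subseteq> A"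
  obtains P Q where "iso_matrices A \<gamma> B \<delta> P Q"
proof -
  let ?CA = "{v. Poly_Mapping.keys v \<subseteq> A}" and ?CB = "{v. Poly_Mapping.keys v \<subseteq> B}"
  obtain \<phi> where bij: "bij_betw \<phi> ?CA ?CB"
    and add: "\<And>v w. Poly_Mapping.keys v \<subseteq> A \<Longrightarrow> Poly_Mapping.keys w \<subseteq> A \<Longrightarrow> \<phi> (v + w) = \<phi> v + \<phi> w"
    and smul: "\<And>c v. Poly_Mapping.keys v \<subseteq> A \<Longrightarrow> \<phi> (smul c v) = smul c (\<phi> v)"
    and mult: "\<And>v w. Poly_Mapping.keys v \<subseteq> A \<Longrightarrow> Poly_Mapping.keys w \<subseteq> A \<Longrightarrow> \<phi> (bilin \<gamma> v w) = bilin \<delta> (\<phi> v) (\<phi> w)"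
    using iso unfolding alg_isomorphic_def by (auto simp: coord_alg_def)
  define \<psi> where "\<psi> = inv_into ?CA \<phi>"
  have \<psi>B: "Poly_Mapping.keys (\<psi> w) \<subseteq> A" "\<phi> (\<psi> w) = w" if "Poly_Mapping.keys w \<subseteq> B" for w
    using that bij_betw_imp_surj_on[OF bij] inv_into_into[of w \<phi> ?CA] f_inv_into_f[of w \<phi> ?CA]
    by (auto simp: \<psi>_def)
  have \<phi>A: "Poly_Mapping.keys (\<phi> v) \<subseteq> B" "\<psi> (\<phi> v) = v" if "Poly_Mapping.keys v \<subseteq> A" for v
    using that bij_betw_imp_surj_on[OF bij] bij_betw_inv_into_left[OF bij] by (auto simp: \<psi>_def)
  have inj: "v = w" if "Poly_Mapping.keys v \<subseteq> A" "Poly_Mapping.keys w \<subseteq> A" "\<phi> v = \<phi> w" for v w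
    using that \<phi>A(2) by metis
  have ka: "Poly_Mapping.keys (v + w) \<subseteq> X" if "Poly_Mapping.keys v \<subseteq> X" "Poly_Mapping.keys w \<subseteq> X"
    for v w :: "'x \<Rightarrow>\<^sub>0 'y::monoid_add" and X using that keys_add[of v w] by blast
  have ks: "Poly_Mapping.keys (smul c v) \<subseteq> X" if "Poly_Mapping.keys v \<subseteq> X" for c :: "'y::comm_ring_1" and v :: "'x \<Rightarrow>\<^sub>0 'y" and X
    using that keys_smul[of c v] by blast
  have addB: "\<psi> (v + w) = \<psi> v + \<psi> w" if "Poly_Mapping.keys v \<subseteq> B" "Poly_Mapping.keys w \<subseteq> B" for v w
    by (rule inj) (use that in \<open>simp_all add: \<psi>B ka add\<close>)
  have smulB: "\<psi> (smul c v) = smul c (\<psi> v)" if "Poly_Mapping.keys v \<subseteq> B" for c v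
    by (rule inj) (use that in \<open>simp_all add: \<psi>B ks smul\<close>)
  define P where "P a = \<phi> (Poly_Mapping.single a 1)" for a
  define Q where "Q b = \<psi> (Poly_Mapping.single b 1)" for b
  have P: "\<phi> v = lin P v" if "Poly_Mapping.keys v \<subseteq> A" for v
    using linear_eq_lin[of A \<phi>, OF add smul that] by (simp add: P_def[abs_def])
  have Q: "\<psi> v = lin Q v" if "Poly_Mapping.keys v \<subseteq> B" for v
    using linear_eq_lin[of B \<psi>, OF addB smulB that] by (simp add: Q_def[abs_def])
  have "iso_matrices A \<gamma> B \<delta> P Q"
    unfolding iso_matrices_def
  proof (intro conjI ballI)
    fix a assume a: "a \<in> A"
    show "Poly_Mapping.keys (P a) \<subseteq> B" using a by (simp add: P_def \<phi>A)
    then show "lin Q (P a) = Poly_Mapping.single a 1" using a by (simp add: P_def \<phi>A flip: Q)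
    fix a' assume a': "a' \<in> A"
    have "\<gamma> a a' = bilin \<gamma> (Poly_Mapping.single a 1) (Poly_Mapping.single a' 1)"
      by (simp add: bilin_def smul_simps)
    then have "\<phi> (\<gamma> a a') = bilin \<delta> (P a) (P a')" using a a' by (simp add: mult P_def)
    then show "lin P (\<gamma> a a') = bilin \<delta> (P a) (P a')" using P[OF \<gamma>[OF a a']] by simp
  next
    fix b assume b: "b \<in> B"
    show "Poly_Mapping.keys (Q b) \<subseteq> A" using b by (simp add: Q_def \<psi>B)
    then show "lin P (Q b) = Poly_Mapping.single b 1" using b by (simp add: Q_def \<psi>B flip: P)
  qed
  then show ?thesis by (rule that)
qed

lemma matrices_imp_coord_iso:
  assumes "iso_matrices A \<gamma> B \<delta> P Q"
  shows "alg_isomorphic (coord_alg A \<gamma>) (coord_alg B \<delta>)"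
proof -
  have P: "Poly_Mapping.keys (P a) \<subseteq> B" "lin Q (P a) = Poly_Mapping.single a 1" if "a \<in> A" for a
    using assms that by (auto simp: iso_matrices_def)
  have Q: "Poly_Mapping.keys (Q b) \<subseteq> A" "lin P (Q b) = Poly_Mapping.single b 1" if "b \<in> B" for b
    using assms that by (auto simp: iso_matrices_def)
  have PA: "Poly_Mapping.keys (lin P v) \<subseteq> B" if "Poly_Mapping.keys v \<subseteq> A" for v
    by (rule keys_lin) (use that P in blast)
  have QB: "Poly_Mapping.keys (lin Q w) \<subseteq> A" if "Poly_Mapping.keys w \<subseteq> B" for w
    by (rule keys_lin) (use that Q in blast)
  have QP: "lin Q (lin P v) = v" if "Poly_Mapping.keys v \<subseteq> A" for v
  proof -
    have "lin Q (lin P v) = lin (\<lambda>a. Poly_Mapping.single a 1) v"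
      unfolding lin_lin by (rule lin_cong) (use that P in blast)
    then show ?thesis by simp
  qed
  have PQ: "lin P (lin Q w) = w" if "Poly_Mapping.keys w \<subseteq> B" for w
  proof -
    have "lin P (lin Q w) = lin (\<lambda>a. Poly_Mapping.single a 1) w"
      unfolding lin_lin by (rule lin_cong) (use that Q in blast)
    then show ?thesis by simp
  qed
  have mult: "lin P (bilin \<gamma> v w) = bilin \<delta> (lin P v) (lin P w)"
    if "Poly_Mapping.keys v \<subseteq> A" "Poly_Mapping.keys w \<subseteq> A" for v w
  proof -
    have "lin P (\<gamma> a a') = bilin \<delta> (P a) (P a')" if "a \<in> A" "a' \<in> A" for a a'
      using assms that by (auto simp: iso_matrices_def)
    then show ?thesis unfolding lin_bilin bilin_lin unfolding bilin_def[of _ v w]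
      by (intro lin_cong) (use that in blast)
  qed
  have "bij_betw (lin P) {v. Poly_Mapping.keys v \<subseteq> A} {w. Poly_Mapping.keys w \<subseteq> B}"
    by (rule bij_betw_byWitness[where f' = "lin Q"]) (auto simp: QP PQ dest: PA QB)
  then show ?thesis unfolding alg_isomorphic_def
    by (intro exI[of _ "lin P"]) (simp add: coord_alg_def lin_add lin_smul mult)
qed

section \<open>Coordinates on an extension of scalars\<close>

locale based_scalar_extension = nonassoc_algebra scale mult + field_extension incl
  for scale :: "'k::field \<Rightarrow> 'a::ab_group_add \<Rightarrow> 'a" and mult :: "'a \<Rightarrow> 'a \<Rightarrow> 'a"
    and incl :: "'k \<Rightarrow> 'f::field" +
  fixes B :: "'a set"
  assumes independent_basis: "\<not> module.dependent scale B"
    and span_basis: "module.span scale B = UNIV"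
begin

abbreviation null_tensors :: "('a \<times> 'f \<Rightarrow>\<^sub>0 int) set"
  where "null_tensors \<equiv> frag.span (tensor_rels incl scale)"

text \<open>
  The coordinates of \<open>a \<otimes> 1\<close>.
\<close>

definition basis_coords :: "'a \<Rightarrow> ('a \<Rightarrow>\<^sub>0 'f)"
  where "basis_coords a = Abs_poly_mapping (\<lambda>b. incl (representation B a b))"

definition tensor_coords :: "('a \<times> 'f \<Rightarrow>\<^sub>0 int) \<Rightarrow> ('a \<Rightarrow>\<^sub>0 'f)"
  where "tensor_coords u = lin (\<lambda>(a, x). smul x (basis_coords a)) (Poly_Mapping.map of_int u)"

text \<open>
  The inverse of \<open>tensor_coords\<close> on classes: every tensor is congruent to exactly one sum of \<open>b \<otimes> x\<^sub>b\<close>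
  over basis elements \<open>b\<close>.
\<close>

definition standard_tensor :: "('a \<Rightarrow>\<^sub>0 'f) \<Rightarrow> ('a \<times> 'f \<Rightarrow>\<^sub>0 int)"
  where "standard_tensor v = (\<Sum>b\<in>Poly_Mapping.keys v. frag_of (b, Poly_Mapping.lookup v b))"

lemma in_span [simp]: "a \<in> span B"
  using span_basis by simp

lemma lookup_basis_coords: "Poly_Mapping.lookup (basis_coords a) b = incl (representation B a b)"
proof -
  have "{b. incl (representation B a b) \<noteq> 0} = {b. representation B a b \<noteq> 0}"
    by (simp add: incl_zero_iff)
  then show ?thesis using finite_representation[of B a] by (simp add: basis_coords_def)
qed

lemma basis_coords_add: "basis_coords (a + b) = basis_coords a + basis_coords b"
  by (rule poly_mapping_eqI)
     (simp add: lookup_basis_coords lookup_add incl_add representation_add independent_basis)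

lemma basis_coords_scale: "basis_coords (scale k a) = smul (incl k) (basis_coords a)"
  by (rule poly_mapping_eqI)
     (simp add: lookup_basis_coords incl_mult representation_scale independent_basis)

lemma basis_coords_basis: "b \<in> B \<Longrightarrow> basis_coords b = Poly_Mapping.single b 1"
  by (rule poly_mapping_eqI)
     (simp add: lookup_basis_coords representation_basis independent_basis lookup_single when_def
       incl_one incl_zero)

lemma keys_basis_coords: "Poly_Mapping.keys (basis_coords a) \<subseteq> B"
  using representation_ne_zero by (auto simp: in_keys_iff lookup_basis_coords incl_zero_iff)

lemma basis_expansion: "(\<Sum>b | representation B a b \<noteq> 0. scale (representation B a b) b) = a"
  using independent_basis by (rule sum_nonzero_representation_eq) simp

lemma linear_eq_lin_basis_coords:
  fixes F :: "'a \<Rightarrow> ('j \<Rightarrow>\<^sub>0 'f)"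
  assumes add: "\<And>a b. F (a + b) = F a + F b" and sc: "\<And>k a. F (scale k a) = smul (incl k) (F a)"
  shows "F a = lin F (basis_coords a)"
proof -
  let ?K = "{b. representation B a b \<noteq> 0}"
  have z: "F 0 = 0" using add[of 0 0] by simp
  have s: "F (sum g I) = (\<Sum>i\<in>I. F (g i))" for g :: "'a \<Rightarrow> 'a" and I
    by (induction I rule: infinite_finite_induct) (auto simp: z add)
  have "F a = F (\<Sum>b\<in>?K. scale (representation B a b) b)" by (simp add: basis_expansion)
  also have "\<dots> = (\<Sum>b\<in>?K. smul (incl (representation B a b)) (F b))" by (simp add: s sc)
  also have "\<dots> = lin F (basis_coords a)"
    by (simp add: lin_superset[OF finite_representation[of B a]] lookup_basis_coords
        in_keys_iff subset_iff incl_zero_iff)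
  finally show ?thesis .
qed

lemma map_of_int_simps:
  fixes u v :: "'x \<Rightarrow>\<^sub>0 int"
  shows "Poly_Mapping.map (of_int :: int \<Rightarrow> 'f) (u - v) = Poly_Mapping.map of_int u - Poly_Mapping.map of_int v"
    "Poly_Mapping.map (of_int :: int \<Rightarrow> 'f) (u + v) = Poly_Mapping.map of_int u + Poly_Mapping.map of_int v"
    "Poly_Mapping.map (of_int :: int \<Rightarrow> 'f) (frag_cmul c u) = smul (of_int c) (Poly_Mapping.map of_int u)"
    "Poly_Mapping.map (of_int :: int \<Rightarrow> 'f) (0 :: 'x \<Rightarrow>\<^sub>0 int) = 0"
  by (rule poly_mapping_eqI; simp add: lookup_map_zero lookup_add lookup_minus)+

lemma tensor_coords_simps:
  "tensor_coords (u - v) = tensor_coords u - tensor_coords v"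
  "tensor_coords (u + v) = tensor_coords u + tensor_coords v"
  "tensor_coords (frag_cmul c u) = smul (of_int c) (tensor_coords u)"
  "tensor_coords (frag_of (a, x)) = smul x (basis_coords a)"
  "tensor_coords 0 = 0"
  by (simp_all add: tensor_coords_def map_of_int_simps lin_diff lin_add lin_smul smul_simps)

lemma keys_tensor_coords: "Poly_Mapping.keys (tensor_coords u) \<subseteq> B"
  unfolding tensor_coords_def using keys_basis_coords keys_smul
  by (intro keys_lin) (fastforce split: prod.splits)

lemma tensor_coords_null:
  assumes "u \<in> null_tensors" shows "tensor_coords u = 0"
  using assms
proof (induction rule: frag.span_induct_alt)
  case base
  show ?case by (simp add: tensor_coords_simps)
next
  case (step c r u)
  from step(1) have "tensor_coords r = 0"
    by (cases rule: tensor_rels_cases)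
       (simp_all add: tensor_coords_simps basis_coords_add basis_coords_scale smul_simps mult.commute)
  then show ?case using step by (simp add: tensor_coords_simps smul_simps)
qed

lemma pure_zero_null: "frag_of (0, x) \<in> null_tensors" "frag_of (a, 0) \<in> null_tensors"
  using frag.span_neg[OF tensor_rel_memb(1)[of 0 0 x incl scale]]
    frag.span_neg[OF tensor_rel_memb(2)[of a 0 0 incl scale]] by simp_all

lemma pure_sum_null:
  assumes "finite I"
  shows "frag_of (sum g I, x) - (\<Sum>i\<in>I. frag_of (g i, x)) \<in> null_tensors"
  using assms
proof (induction I)
  case empty
  show ?case by (simp add: pure_zero_null)
next
  case (insert i I)
  have "(frag_of (g i + sum g I, x) - frag_of (g i, x) - frag_of (sum g I, x))
      + (frag_of (sum g I, x) - (\<Sum>i\<in>I. frag_of (g i, x))) \<in> null_tensors"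
    using insert.IH by (intro frag.span_add tensor_rel_memb)
  then show ?case using insert by (simp add: algebra_simps)
qed

text \<open>
  Enlarging the index set beyond the support only adds the null tensors \<open>b \<otimes> 0\<close>.  This lets
  vectors with different supports be compared term by term.
\<close>

lemma standard_tensor_superset:
  assumes "finite I" "Poly_Mapping.keys v \<subseteq> I"
  shows "standard_tensor v - (\<Sum>b\<in>I. frag_of (b, Poly_Mapping.lookup v b)) \<in> null_tensors"
proof -
  have "(\<Sum>b\<in>I. frag_of (b, Poly_Mapping.lookup v b))
      = standard_tensor v + (\<Sum>b\<in>I - Poly_Mapping.keys v. frag_of (b, Poly_Mapping.lookup v b))"
    unfolding standard_tensor_def using sum.subset_diff[OF assms(2,1)] by (simp add: add.commute)
  moreover have "(\<Sum>b\<in>I - Poly_Mapping.keys v. frag_of (b, Poly_Mapping.lookup v b)) \<in> null_tensors"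
    by (intro frag.span_sum) (auto simp: in_keys_iff pure_zero_null)
  ultimately show ?thesis using frag.span_neg by fastforce
qed

lemma standard_tensor_diff:
  "standard_tensor (v - w) - (standard_tensor v - standard_tensor w) \<in> null_tensors"
proof -
  let ?I = "Poly_Mapping.keys v \<union> Poly_Mapping.keys w"
  let ?s = "\<lambda>v. \<Sum>b\<in>?I. frag_of (b, Poly_Mapping.lookup v b)"
  have fin: "finite ?I" by simp
  have "?s (v - w) - (?s v - ?s w) = (\<Sum>b\<in>?I. frag_of (b, Poly_Mapping.lookup (v - w) b)
      - frag_of (b, Poly_Mapping.lookup v b) + frag_of (b, Poly_Mapping.lookup w b))"
    by (simp only: sum.distrib sum_subtractf) simp
  also have "\<dots> \<in> null_tensors"
  proof (rule frag.span_sum)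
    fix b
    show "frag_of (b, Poly_Mapping.lookup (v - w) b)
      - frag_of (b, Poly_Mapping.lookup v b) + frag_of (b, Poly_Mapping.lookup w b) \<in> null_tensors"
      using frag.span_neg[OF tensor_rel_memb(2)[of b "Poly_Mapping.lookup (v - w) b" "Poly_Mapping.lookup w b" incl scale]]
      by (simp add: lookup_minus algebra_simps)
  qed
  finally have s: "?s (v - w) - (?s v - ?s w) \<in> null_tensors" .
  have k: "Poly_Mapping.keys (v - w) \<subseteq> ?I" by (rule keys_diff)
  have e: "standard_tensor u - ?s u \<in> null_tensors" if "Poly_Mapping.keys u \<subseteq> ?I" for u
    by (rule standard_tensor_superset[OF fin that])
  from frag.span_add[OF frag.span_diff[OF e[OF k] frag.span_diff[OF e[of v] e[of w]]] s]
  show ?thesis by (simp add: algebra_simps)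
qed

text \<open>
  Differences reduce this to pure tensors \<open>a \<otimes> x\<close>, where \<open>a\<close> is expanded in the basis and its
  coefficients are moved to the right factor.
\<close>

lemma standard_tensor_coords: "u - standard_tensor (tensor_coords u) \<in> null_tensors"
proof (rule frag_induction[of u UNIV, OF subset_UNIV])
  show "0 - standard_tensor (tensor_coords 0) \<in> null_tensors"
    by (simp add: tensor_coords_simps standard_tensor_def frag.span_zero)
next
  fix p :: "'a \<times> 'f"
  obtain a x where p: "p = (a, x)" by (cases p)
  let ?K = "{b. representation B a b \<noteq> 0}" and ?r = "representation B a"
  let ?v = "smul x (basis_coords a)"
  have fin: "finite ?K" by (rule finite_representation)
  have "Poly_Mapping.keys ?v \<subseteq> ?K" by (auto simp: in_keys_iff lookup_basis_coords incl_zero)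
  note 1 = standard_tensor_superset[OF fin this]
  have 2: "frag_of (a, x) - (\<Sum>b\<in>?K. frag_of (scale (?r b) b, x)) \<in> null_tensors"
    using pure_sum_null[OF fin, of "\<lambda>b. scale (?r b) b" x] by (simp add: basis_expansion)
  have "(\<Sum>b\<in>?K. frag_of (scale (?r b) b, x) - frag_of (b, incl (?r b) * x)) \<in> null_tensors"
    by (intro frag.span_sum tensor_rel_memb)
  then have 3: "(\<Sum>b\<in>?K. frag_of (scale (?r b) b, x)) - (\<Sum>b\<in>?K. frag_of (b, Poly_Mapping.lookup ?v b)) \<in> null_tensors"
    by (simp add: sum_subtractf lookup_basis_coords mult.commute)
  show "frag_of p - standard_tensor (tensor_coords (frag_of p)) \<in> null_tensors"
    using frag.span_diff[OF frag.span_add[OF 2 3] 1] by (simp add: p tensor_coords_simps algebra_simps)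
next
  fix u v assume "u - standard_tensor (tensor_coords u) \<in> null_tensors"
    "v - standard_tensor (tensor_coords v) \<in> null_tensors"
  from frag.span_diff[OF frag.span_diff[OF this]
      standard_tensor_diff[of "tensor_coords u" "tensor_coords v"]]
  show "u - v - standard_tensor (tensor_coords (u - v)) \<in> null_tensors"
    by (simp add: tensor_coords_simps algebra_simps)
qed

text \<open>
  The coordinates are a complete invariant of the class of a tensor, so that the quotient in the
  definition of the tensor product can be traded for equality of coordinates.
\<close>

lemma tensor_coords_eq_iff: "tensor_coords u = tensor_coords v \<longleftrightarrow> u - v \<in> null_tensors"
proof
  assume e: "tensor_coords u = tensor_coords v"
  from frag.span_diff[OF standard_tensor_coords[of u] standard_tensor_coords[of v]]
  show "u - v \<in> null_tensors" by (simp add: e)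
next
  assume "u - v \<in> null_tensors"
  from tensor_coords_null[OF this] show "tensor_coords u = tensor_coords v"
    by (simp add: tensor_coords_simps)
qed

lemma tensor_coords_standard:
  assumes "Poly_Mapping.keys v \<subseteq> B"
  shows "tensor_coords (standard_tensor v) = v"
proof -
  have s: "tensor_coords (sum g I) = (\<Sum>i\<in>I. tensor_coords (g i))" for g :: "'a \<Rightarrow> _" and I
    by (induction I rule: infinite_finite_induct) (auto simp: tensor_coords_simps)
  have "tensor_coords (standard_tensor v)
      = (\<Sum>b\<in>Poly_Mapping.keys v. smul (Poly_Mapping.lookup v b) (basis_coords b))"
    by (simp add: standard_tensor_def s tensor_coords_simps)
  also have "\<dots> = lin (\<lambda>b. Poly_Mapping.single b 1) v"
    unfolding lin_def by (rule sum.cong) (use assms basis_coords_basis in auto)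
  finally show ?thesis by simp
qed

lemma frag_additive_unique:
  fixes f g :: "('b \<Rightarrow>\<^sub>0 int) \<Rightarrow> 'd::ab_group_add"
  assumes "\<And>u v. f (u - v) = f u - f v" "\<And>u v. g (u - v) = g u - g v"
    and "\<And>b. f (frag_of b) = g (frag_of b)"
  shows "f u = g u"
proof (rule frag_induction[of u UNIV, OF subset_UNIV])
  show "f 0 = g 0" using assms(1)[of 0 0] assms(2)[of 0 0] by simp
qed (auto simp: assms)

lemma tensor_coords_smult: "tensor_coords (free_smult c u) = smul c (tensor_coords u)"
  by (rule frag_additive_unique[where f = "\<lambda>u. tensor_coords (free_smult c u)"])
     (auto simp: free_smult_diff tensor_coords_simps smul_simps)

lemma basis_coords_mult: "basis_coords (mult a b) = bilin (\<lambda>i j. basis_coords (mult i j)) (basis_coords a) (basis_coords b)"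
proof -
  have left: "basis_coords (mult a b) = lin (\<lambda>i. basis_coords (mult i b)) (basis_coords a)"
    by (rule linear_eq_lin_basis_coords)
       (simp_all add: mult_add_left mult_scale_left basis_coords_add basis_coords_scale)
  have right: "(\<lambda>i. basis_coords (mult i b)) = (\<lambda>i. lin (\<lambda>j. basis_coords (mult i j)) (basis_coords b))"
    by (rule ext, rule linear_eq_lin_basis_coords)
       (simp_all add: mult_add_right mult_scale_right basis_coords_add basis_coords_scale)
  show ?thesis unfolding bilin_def by (subst left, subst right) (rule refl)
qed

lemma tensor_coords_mult:
  "tensor_coords (free_mult mult u v)
    = bilin (\<lambda>i j. basis_coords (mult i j)) (tensor_coords u) (tensor_coords v)"
proof (rule frag_additive_unique[where f = "\<lambda>u. tensor_coords (free_mult mult u v)"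
      and g = "\<lambda>u. bilin (\<lambda>i j. basis_coords (mult i j)) (tensor_coords u) (tensor_coords v)"])
  fix p :: "'a \<times> 'f"
  obtain a x where p: "p = (a, x)" by (cases p)
  show "tensor_coords (free_mult mult (frag_of p) v)
      = bilin (\<lambda>i j. basis_coords (mult i j)) (tensor_coords (frag_of p)) (tensor_coords v)"
  proof (rule frag_additive_unique[where f = "\<lambda>v. tensor_coords (free_mult mult (frag_of p) v)"
      and g = "\<lambda>v. bilin (\<lambda>i j. basis_coords (mult i j)) (tensor_coords (frag_of p)) (tensor_coords v)"])
    fix q :: "'a \<times> 'f"
    obtain b y where q: "q = (b, y)" by (cases q)
    show "tensor_coords (free_mult mult (frag_of p) (frag_of q))
      = bilin (\<lambda>i j. basis_coords (mult i j)) (tensor_coords (frag_of p)) (tensor_coords (frag_of q))"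
      by (simp add: p q tensor_coords_simps bilin_simps smul_simps basis_coords_mult[of a b] mult.commute)
  qed (simp_all add: free_mult_diff_right tensor_coords_simps bilin_diff_right)
qed (simp_all add: free_mult_diff_left tensor_coords_simps bilin_simps)

theorem base_change_isomorphic_coord_alg:
  "alg_isomorphic (base_change incl scale mult) (coord_alg B (\<lambda>i j. basis_coords (mult i j)))"
proof -
  let ?cls = "\<lambda>u. tensor_cong incl scale `` {u}"
  let ?M = "base_change incl scale mult"
  have alg: "nonassoc_algebra scale mult" by unfold_locales
  define \<Phi> where "\<Phi> X = tensor_coords (SOME u. X = ?cls u)" for X
  have \<Phi>: "\<Phi> (?cls u) = tensor_coords u" for u
  proof -
    have "?cls u = ?cls (SOME u'. ?cls u = ?cls u')" by (rule someI) (rule refl)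
    then show ?thesis unfolding cls_eq_iff \<Phi>_def tensor_coords_eq_iff[symmetric] by (rule sym)
  qed
  have car: "\<exists>u. X = ?cls u" if "X \<in> alg_carrier ?M" for X
    using that by (simp add: base_change_carrier_iff)
  have "bij_betw \<Phi> (alg_carrier ?M) {v. Poly_Mapping.keys v \<subseteq> B}"
  proof (rule bij_betw_byWitness[where f' = "\<lambda>v. ?cls (standard_tensor v)"])
    show "\<forall>X\<in>alg_carrier ?M. ?cls (standard_tensor (\<Phi> X)) = X"
    proof
      fix X assume "X \<in> alg_carrier ?M"
      then obtain u where "X = ?cls u" using car by blast
      then show "?cls (standard_tensor (\<Phi> X)) = X"
        using frag.span_neg[OF standard_tensor_coords[of u]] by (simp add: \<Phi> cls_eq_iff)
    qed
    show "\<forall>v\<in>{v. Poly_Mapping.keys v \<subseteq> B}. \<Phi> (?cls (standard_tensor v)) = v"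
      by (simp add: \<Phi> tensor_coords_standard)
    show "\<Phi> ` alg_carrier ?M \<subseteq> {v. Poly_Mapping.keys v \<subseteq> B}"
      using car \<Phi> keys_tensor_coords by fastforce
    show "(\<lambda>v. ?cls (standard_tensor v)) ` {v. Poly_Mapping.keys v \<subseteq> B} \<subseteq> alg_carrier ?M"
      using base_change_cls by blast
  qed
  then show ?thesis unfolding alg_isomorphic_def
    by (intro exI[of _ \<Phi>]) (auto simp: coord_alg_def \<Phi> base_change_add base_change_smult
        base_change_mult[OF alg] tensor_coords_simps tensor_coords_smult tensor_coords_mult dest!: car)
qed

end

section \<open>Transfer of isomorphisms\<close>

lemma alg_isomorphic_trans:
  assumes "alg_isomorphic L M" "alg_isomorphic M N" shows "alg_isomorphic L N"
proof -
  obtain f where f: "bij_betw f (alg_carrier L) (alg_carrier M)"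
    "\<And>X Y. X \<in> alg_carrier L \<Longrightarrow> Y \<in> alg_carrier L \<Longrightarrow> f (alg_add L X Y) = alg_add M (f X) (f Y)"
    "\<And>c X. X \<in> alg_carrier L \<Longrightarrow> f (alg_smult L c X) = alg_smult M c (f X)"
    "\<And>X Y. X \<in> alg_carrier L \<Longrightarrow> Y \<in> alg_carrier L \<Longrightarrow> f (alg_mult L X Y) = alg_mult M (f X) (f Y)"
    using assms(1) unfolding alg_isomorphic_def by blast
  obtain g where g: "bij_betw g (alg_carrier M) (alg_carrier N)"
    "\<And>X Y. X \<in> alg_carrier M \<Longrightarrow> Y \<in> alg_carrier M \<Longrightarrow> g (alg_add M X Y) = alg_add N (g X) (g Y)"
    "\<And>c X. X \<in> alg_carrier M \<Longrightarrow> g (alg_smult M c X) = alg_smult N c (g X)"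
    "\<And>X Y. X \<in> alg_carrier M \<Longrightarrow> Y \<in> alg_carrier M \<Longrightarrow> g (alg_mult M X Y) = alg_mult N (g X) (g Y)"
    using assms(2) unfolding alg_isomorphic_def by blast
  have "f X \<in> alg_carrier M" if "X \<in> alg_carrier L" for X
    using bij_betwE[OF f(1)] that by blast
  then show ?thesis unfolding alg_isomorphic_def
    by (intro exI[of _ "g \<circ> f"]) (simp add: bij_betw_trans[OF f(1) g(1)] f(2-) g(2-))
qed

lemma alg_isomorphic_sym:
  assumes "carrier_algebra M" "alg_isomorphic M N" shows "alg_isomorphic N M"
proof -
  interpret carrier_algebra M by (rule assms(1))
  obtain f where f: "bij_betw f (alg_carrier M) (alg_carrier N)"
    "\<And>X Y. X \<in> alg_carrier M \<Longrightarrow> Y \<in> alg_carrier M \<Longrightarrow> f (alg_add M X Y) = alg_add N (f X) (f Y)"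
    "\<And>c X. X \<in> alg_carrier M \<Longrightarrow> f (alg_smult M c X) = alg_smult N c (f X)"
    "\<And>X Y. X \<in> alg_carrier M \<Longrightarrow> Y \<in> alg_carrier M \<Longrightarrow> f (alg_mult M X Y) = alg_mult N (f X) (f Y)"
    using assms(2) unfolding alg_isomorphic_def by blast
  define g where "g = inv_into (alg_carrier M) f"
  have g: "g Y \<in> alg_carrier M" "f (g Y) = Y" if "Y \<in> alg_carrier N" for Y
    using that bij_betw_imp_surj_on[OF f(1)] inv_into_into[of Y f] f_inv_into_f[of Y f] by (auto simp: g_def)
  have gf: "g (f X) = X" if "X \<in> alg_carrier M" for X
    using bij_betw_inv_into_left[OF f(1) that] by (simp add: g_def)
  have gI: "g Y = X" if "f X = Y" "X \<in> alg_carrier M" for X Y using gf that by blast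
  have "bij_betw g (alg_carrier N) (alg_carrier M)" unfolding g_def by (rule bij_betw_inv_into[OF f(1)])
  then show ?thesis unfolding alg_isomorphic_def
    by (intro exI[of _ g]) (auto intro!: gI add_closed smult_closed mult_closed simp: f(2-) g)
qed

lemma ring_hom_on_simps:
  assumes "ring_hom_on S h"
  shows "h 0 = 0" "h 1 = 1" "x \<in> S \<Longrightarrow> y \<in> S \<Longrightarrow> h (x + y) = h x + h y"
    "x \<in> S \<Longrightarrow> y \<in> S \<Longrightarrow> h (x * y) = h x * h y"
proof -
  have *: "h 1 = 1" "\<And>x y. x \<in> S \<Longrightarrow> y \<in> S \<Longrightarrow> h (x + y) = h x + h y \<and> h (x * y) = h x * h y"
    and S: "is_subring S"
    using assms by (auto simp: ring_hom_on_def)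
  show "h 0 = 0" using *(2)[of 0 0] subring_closed(1)[OF S] by simp
  show "h 1 = 1" "x \<in> S \<Longrightarrow> y \<in> S \<Longrightarrow> h (x + y) = h x + h y"
    "x \<in> S \<Longrightarrow> y \<in> S \<Longrightarrow> h (x * y) = h x * h y" using * by auto
qed

lemma ring_hom_on_sum:
  assumes h: "ring_hom_on S h" and "\<And>i. i \<in> I \<Longrightarrow> f i \<in> S"
  shows "h (sum f I) = (\<Sum>i\<in>I. h (f i))"
proof -
  have S: "is_subring S" using h by (simp add: ring_hom_on_def)
  show ?thesis using assms(2)
    by (induction I rule: infinite_finite_induct)
       (auto simp: ring_hom_on_simps[OF h] subring_sum[OF S])
qed

lemma keys_map: "h 0 = 0 \<Longrightarrow> Poly_Mapping.keys (Poly_Mapping.map h v) \<subseteq> Poly_Mapping.keys v"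
  by (auto simp: in_keys_iff lookup_map_zero)

definition coeffs_in :: "'f::zero set \<Rightarrow> ('i \<Rightarrow>\<^sub>0 'f) \<Rightarrow> bool"
  where "coeffs_in S v \<longleftrightarrow> (\<forall>i. Poly_Mapping.lookup v i \<in> S)"

lemma coeffs_in_lin:
  assumes "is_subring S" "coeffs_in S v" "\<And>i. i \<in> Poly_Mapping.keys v \<Longrightarrow> coeffs_in S (f i)"
  shows "coeffs_in S (lin f v)"
  using assms by (auto simp: coeffs_in_def lin_def lookup_sum intro!: subring_sum subring_closed(6))

lemma map_lin:
  assumes h: "ring_hom_on S h" and v: "coeffs_in S v"
    and f: "\<And>i. i \<in> Poly_Mapping.keys v \<Longrightarrow> coeffs_in S (f i)"
  shows "Poly_Mapping.map h (lin f v) = lin (\<lambda>i. Poly_Mapping.map h (f i)) (Poly_Mapping.map h v)"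
proof (rule poly_mapping_eqI)
  fix k
  note hs = ring_hom_on_simps[OF h]
  have S: "is_subring S" using h by (simp add: ring_hom_on_def)
  have mem: "Poly_Mapping.lookup v i \<in> S" "Poly_Mapping.lookup (f i) k \<in> S" if "i \<in> Poly_Mapping.keys v" for i
    using v f that by (auto simp: coeffs_in_def)
  have "Poly_Mapping.lookup (lin (\<lambda>i. Poly_Mapping.map h (f i)) (Poly_Mapping.map h v)) k
      = (\<Sum>i\<in>Poly_Mapping.keys v. h (Poly_Mapping.lookup v i) * h (Poly_Mapping.lookup (f i) k))"
    by (simp add: lin_superset[OF _ keys_map] lookup_sum lookup_map_zero hs)
  also have "\<dots> = h (\<Sum>i\<in>Poly_Mapping.keys v. Poly_Mapping.lookup v i * Poly_Mapping.lookup (f i) k)"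
    by (subst ring_hom_on_sum[OF h]) (auto simp: mem hs intro!: subring_closed(6)[OF S])
  also have "\<dots> = Poly_Mapping.lookup (Poly_Mapping.map h (lin f v)) k"
    by (simp add: lookup_map_zero hs lin_def lookup_sum)
  finally show "Poly_Mapping.lookup (Poly_Mapping.map h (lin f v)) k
      = Poly_Mapping.lookup (lin (\<lambda>i. Poly_Mapping.map h (f i)) (Poly_Mapping.map h v)) k" ..
qed

text \<open>
  Each of the equations is an identity between linear combinations with coefficients in \<open>S\<close>, and a ring
  homomorphism on \<open>S\<close> preserves such identities.
\<close>

lemma iso_matrices_map:
  assumes iso: "iso_matrices A \<gamma> B \<delta> P Q" and h: "ring_hom_on S h"
    and P: "\<And>a. a \<in> A \<Longrightarrow> coeffs_in S (P a)" and Q: "\<And>b. b \<in> B \<Longrightarrow> coeffs_in S (Q b)"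
    and \<gamma>: "\<And>a a'. coeffs_in S (\<gamma> a a')" "\<And>a a'. Poly_Mapping.keys (\<gamma> a a') \<subseteq> A"
    and \<delta>: "\<And>b b'. coeffs_in S (\<delta> b b')"
  shows "iso_matrices A (\<lambda>a a'. Poly_Mapping.map h (\<gamma> a a')) B (\<lambda>b b'. Poly_Mapping.map h (\<delta> b b'))
    (\<lambda>a. Poly_Mapping.map h (P a)) (\<lambda>b. Poly_Mapping.map h (Q b))"
proof -
  note hs = ring_hom_on_simps[OF h]
  have S: "is_subring S" using h by (simp add: ring_hom_on_def)
  have isoP: "Poly_Mapping.keys (P a) \<subseteq> B" "lin Q (P a) = Poly_Mapping.single a 1" if "a \<in> A" for a
    using iso that by (auto simp: iso_matrices_def)
  have isoQ: "Poly_Mapping.keys (Q b) \<subseteq> A" "lin P (Q b) = Poly_Mapping.single b 1" if "b \<in> B" for b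
    using iso that by (auto simp: iso_matrices_def)
  note keys = keys_map[of h, OF hs(1)]
  show ?thesis unfolding iso_matrices_def
  proof (intro conjI ballI)
    fix a assume a: "a \<in> A"
    show "Poly_Mapping.keys (Poly_Mapping.map h (P a)) \<subseteq> B" by (rule order_trans[OF keys isoP(1)[OF a]])
    have "Poly_Mapping.map h (lin Q (P a)) = lin (\<lambda>b. Poly_Mapping.map h (Q b)) (Poly_Mapping.map h (P a))"
      by (intro map_lin[OF h P[OF a] Q] subsetD[OF isoP(1)[OF a]])
    then show "lin (\<lambda>b. Poly_Mapping.map h (Q b)) (Poly_Mapping.map h (P a)) = Poly_Mapping.single a 1"
      by (simp add: isoP(2)[OF a] hs)
    fix a' assume a': "a' \<in> A"
    have "lin (\<lambda>a. Poly_Mapping.map h (P a)) (Poly_Mapping.map h (\<gamma> a a')) = Poly_Mapping.map h (lin P (\<gamma> a a'))"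
      by (intro map_lin[OF h \<gamma>(1) P, symmetric] subsetD[OF \<gamma>(2)])
    also have "\<dots> = Poly_Mapping.map h (lin (\<lambda>i. lin (\<delta> i) (P a')) (P a))"
      using iso a a' by (simp add: iso_matrices_def bilin_def)
    also have "\<dots> = lin (\<lambda>i. Poly_Mapping.map h (lin (\<delta> i) (P a'))) (Poly_Mapping.map h (P a))"
      by (intro map_lin[OF h P[OF a]] coeffs_in_lin[OF S P[OF a']] \<delta>)
    also have "\<dots> = lin (\<lambda>i. lin (\<lambda>k. Poly_Mapping.map h (\<delta> i k)) (Poly_Mapping.map h (P a'))) (Poly_Mapping.map h (P a))"
      by (simp add: map_lin[OF h P[OF a'] \<delta>])
    finally show "lin (\<lambda>a. Poly_Mapping.map h (P a)) (Poly_Mapping.map h (\<gamma> a a'))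
      = bilin (\<lambda>b b'. Poly_Mapping.map h (\<delta> b b')) (Poly_Mapping.map h (P a)) (Poly_Mapping.map h (P a'))"
      by (simp add: bilin_def)
  next
    fix b assume b: "b \<in> B"
    show "Poly_Mapping.keys (Poly_Mapping.map h (Q b)) \<subseteq> A" by (rule order_trans[OF keys isoQ(1)[OF b]])
    have "Poly_Mapping.map h (lin P (Q b)) = lin (\<lambda>a. Poly_Mapping.map h (P a)) (Poly_Mapping.map h (Q b))"
      by (intro map_lin[OF h Q[OF b] P] subsetD[OF isoQ(1)[OF b]])
    then show "lin (\<lambda>a. Poly_Mapping.map h (P a)) (Poly_Mapping.map h (Q b)) = Poly_Mapping.single b 1"
      by (simp add: isoQ(2)[OF b] hs)
  qed
qed

text \<open>
  Each row has finitely many nonzero entries, so an infinite index set bounds the number of all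
  entries.
\<close>

lemma matrix_entries_small:
  fixes P :: "'i \<Rightarrow> 'j \<Rightarrow>\<^sub>0 'f::zero" and Q :: "'j \<Rightarrow> 'i \<Rightarrow>\<^sub>0 'f"
  assumes A: "A \<approx> W" and B: "B \<approx> W" and W: "W \<prec> U"
  defines "X \<equiv> (\<Union>a\<in>A. Poly_Mapping.range (P a)) \<union> (\<Union>b\<in>B. Poly_Mapping.range (Q b))"
  shows "finite X \<or> X \<prec> U"
proof (cases "finite W")
  case True
  then have "finite A" "finite B" using A B eqpoll_finite_iff by blast+
  then show ?thesis by (simp add: X_def)
next
  case False
  let ?Y = "\<Union>a\<in>A. Poly_Mapping.range (P a)" and ?Z = "\<Union>b\<in>B. Poly_Mapping.range (Q b)"
  have Y: "?Y \<lesssim> W" "?Z \<lesssim> W"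
    by (rule UN_lepoll_infinite[OF False];
        simp add: A B eqpoll_imp_lepoll finite_lepoll_infinite[OF False])+
  have "(\<Union>T\<in>{?Y, ?Z}. T) \<lesssim> W"
  proof (rule UN_lepoll_infinite[OF False])
    show "{?Y, ?Z} \<lesssim> W" by (rule finite_lepoll_infinite[OF False]) simp
  qed (use Y in blast)
  then have "X \<lesssim> W" by (simp add: X_def)
  then show ?thesis using W lesspoll_trans1 by blast
qed

theorem corollary5p5:
  fixes incl1 :: "'k::field \<Rightarrow> 'f1::field"
    and incl2 :: "'k \<Rightarrow> 'f2::field"
    and inclbar :: "'k \<Rightarrow> 'kbar::alg_closed_field"
    and j :: "'kbar \<Rightarrow> 'f2"
    and scaleA :: "'k \<Rightarrow> 'a::ab_group_add \<Rightarrow> 'a"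
    and multA :: "'a \<Rightarrow> 'a \<Rightarrow> 'a"
    and scaleB :: "'k \<Rightarrow> 'b::ab_group_add \<Rightarrow> 'b"
    and multB :: "'b \<Rightarrow> 'b \<Rightarrow> 'b"
    and \<omega> :: "'w set"
  assumes "field_extension incl1" and "field_extension incl2"
    and "nonassoc_algebra scaleA multA" and "nonassoc_algebra scaleB multB"
    and "has_dimension scaleA \<omega>" and "has_dimension scaleB \<omega>"
    and "\<omega> \<prec> (UNIV :: 'k set)"
    and "algebraic_closure_of inclbar" and "field_extension j" and "j \<circ> inclbar = incl2"
    and "alg_isomorphic (base_change incl1 scaleA multA) (base_change incl1 scaleB multB)"
  shows "alg_isomorphic (base_change incl2 scaleA multA) (base_change incl2 scaleB multB)"
proof -
  note i1 = assms(1) and i2 = assms(2) and algA = assms(3) and algB = assms(4)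
  have ibar: "field_extension inclbar" using assms(8) by (simp add: algebraic_closure_of_def)
  obtain A where A: "\<not> module.dependent scaleA A" "module.span scaleA A = UNIV" "A \<approx> \<omega>"
    using assms(5) unfolding has_dimension_def by blast
  obtain B where B: "\<not> module.dependent scaleB B" "module.span scaleB B = UNIV" "B \<approx> \<omega>"
    using assms(6) unfolding has_dimension_def by blast
  interpret A1: based_scalar_extension scaleA multA incl1 A
    by (rule based_scalar_extension.intro[OF algA i1 based_scalar_extension_axioms.intro[OF A(1,2)]])
  interpret A2: based_scalar_extension scaleA multA incl2 A
    by (rule based_scalar_extension.intro[OF algA i2 based_scalar_extension_axioms.intro[OF A(1,2)]])
  interpret B1: based_scalar_extension scaleB multB incl1 B
    by (rule based_scalar_extension.intro[OF algB i1 based_scalar_extension_axioms.intro[OF B(1,2)]])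
  interpret B2: based_scalar_extension scaleB multB incl2 B
    by (rule based_scalar_extension.intro[OF algB i2 based_scalar_extension_axioms.intro[OF B(1,2)]])
  interpret j: field_extension j by (rule assms(9))
  let ?\<gamma>1 = "\<lambda>a a'. A1.basis_coords (multA a a')" and ?\<delta>1 = "\<lambda>b b'. B1.basis_coords (multB b b')"
  let ?\<gamma>2 = "\<lambda>a a'. A2.basis_coords (multA a a')" and ?\<delta>2 = "\<lambda>b b'. B2.basis_coords (multB b b')"

  have "alg_isomorphic (coord_alg A ?\<gamma>1) (base_change incl1 scaleA multA)"
    by (rule alg_isomorphic_sym[OF carrier_algebra_base_change[OF algA]
        A1.base_change_isomorphic_coord_alg])
  from alg_isomorphic_trans[OF alg_isomorphic_trans[OF this assms(11)]
      B1.base_change_isomorphic_coord_alg]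
  have "alg_isomorphic (coord_alg A ?\<gamma>1) (coord_alg B ?\<delta>1)" .
  then obtain P Q where PQ: "iso_matrices A ?\<gamma>1 B ?\<delta>1 P Q"
    using coord_iso_imp_matrices A1.keys_basis_coords by metis

  define X where "X = (\<Union>a\<in>A. Poly_Mapping.range (P a)) \<union> (\<Union>b\<in>B. Poly_Mapping.range (Q b))"
  have small: "finite X \<or> X \<prec> (UNIV :: 'k set)"
    unfolding X_def by (rule matrix_entries_small[OF A(3) B(3) assms(7)])
  from specialization_exists[OF i1 ibar small]
  obtain S g where g: "ring_hom_on S g" "range incl1 \<subseteq> S" "X \<subseteq> S" "\<And>k. g (incl1 k) = inclbar k"
    by metis
  define h where "h = j \<circ> g"
  have S: "is_subring S" using g(1) by (simp add: ring_hom_on_def)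
  have h: "ring_hom_on S h"
    using g(1) by (simp add: ring_hom_on_def h_def j.incl_one j.incl_add j.incl_mult)
  have hincl: "h (incl1 k) = incl2 k" for k
    using assms(10) by (auto simp: h_def g(4))
  have inS: "coeffs_in S v" if "Poly_Mapping.range v \<subseteq> S" for v :: "'x \<Rightarrow>\<^sub>0 'f1"
    unfolding coeffs_in_def
  proof
    fix i
    show "Poly_Mapping.lookup v i \<in> S"
      using that subring_closed(1)[OF S] in_keys_lookup_in_range[of i v]
      by (cases "i \<in> Poly_Mapping.keys v") (auto simp: in_keys_iff)
  qed
  have "iso_matrices A (\<lambda>a a'. Poly_Mapping.map h (?\<gamma>1 a a')) B (\<lambda>b b'. Poly_Mapping.map h (?\<delta>1 b b'))
    (\<lambda>a. Poly_Mapping.map h (P a)) (\<lambda>b. Poly_Mapping.map h (Q b))"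
  proof (rule iso_matrices_map[OF PQ h])
    show "coeffs_in S (P a)" if "a \<in> A" for a using g(3) that by (intro inS) (auto simp: X_def)
    show "coeffs_in S (Q b)" if "b \<in> B" for b using g(3) that by (intro inS) (auto simp: X_def)
    show "coeffs_in S (?\<gamma>1 a a')" "coeffs_in S (?\<delta>1 b b')" for a a' b b'
      using g(2) by (auto simp: coeffs_in_def A1.lookup_basis_coords B1.lookup_basis_coords)
  qed (rule A1.keys_basis_coords)
  moreover have "Poly_Mapping.map h (A1.basis_coords a) = A2.basis_coords a" for a
    by (rule poly_mapping_eqI)
      (simp add: lookup_map_zero ring_hom_on_simps[OF h] A1.lookup_basis_coords A2.lookup_basis_coords hincl)
  moreover have "Poly_Mapping.map h (B1.basis_coords b) = B2.basis_coords b" for b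
    by (rule poly_mapping_eqI)
      (simp add: lookup_map_zero ring_hom_on_simps[OF h] B1.lookup_basis_coords B2.lookup_basis_coords hincl)
  ultimately have "iso_matrices A ?\<gamma>2 B ?\<delta>2
      (\<lambda>a. Poly_Mapping.map h (P a)) (\<lambda>b. Poly_Mapping.map h (Q b))" by simp
  then have "alg_isomorphic (coord_alg A ?\<gamma>2) (coord_alg B ?\<delta>2)" by (rule matrices_imp_coord_iso)
  from alg_isomorphic_trans[OF A2.base_change_isomorphic_coord_alg this]
  show ?thesis
    by (rule alg_isomorphic_trans)
      (rule alg_isomorphic_sym[OF carrier_algebra_base_change[OF algB]
        B2.base_change_isomorphic_coord_alg])
qed

end
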